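(* For every integer $r\ge 1$ there exists a real number $\delta_0>0$ (depending only on $r$) such that for all real $\delta$ with $0<\delta<\delta_0$ one has $$f_{2r+1}(\delta)=\frac{r-1}{r}+\delta .$$
   Context: All graphs are finite and simple. For a graph $G$, $\alpha(G)$ is the maximum size of an independent set and $e(G)$ the number of edges. For a positive integer $n$, a positive real $m$ and a graph $F$, $\mathrm{RT}(n,m,F)$ denotes the maximum number of edges $e(G)$ over all graphs $G$ on $n$ vertices that do not contain $F$ as a (not necessarily induced) subgraph and satisfy $\alpha(G)<m$. For an integer $t\ge 3$ the Ramsey-Turán density function $f_t\colon(0,1)\to\mathbb{R}$ is $$f_t(\delta)=\lim_{n\to\infty}\frac{\mathrm{RT}(n,\delta n,K_t)}{n^2/2},$$ where for fixed $\delta$ and large $n$ graphs as required exist, and the limit is known to exist. The paper's hypothesis "$\delta\ll r^{-1}$" means that $\delta$ is sufficiently small in a sense depending only on $r$. *)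

theory Defs
  imports Complex_Main "HOL-Library.Ramsey"
begin

text \<open>
  A graph is given by its vertex set \<open>V\<close> and its edge set \<open>E\<close>, whose members are two-element
  subsets of \<open>V\<close>. The predicate \<open>indep\<close> on vertex sets is the one of \<open>HOL-Library.Ramsey\<close>.
\<close>

definition fin_graph :: "'a set \<Rightarrow> 'a set set \<Rightarrow> bool" where
  "fin_graph V E \<longleftrightarrow> finite V \<and> E \<subseteq> [V]\<^bsup>2\<^esup>"

definition indep_number :: "'a set \<Rightarrow> 'a set set \<Rightarrow> nat" where
  "indep_number V E = Max {card S | S. S \<subseteq> V \<and> indep S E}"

definition contains_subgraph ::
    "'a set \<times> 'a set set \<Rightarrow> 'b set \<times> 'b set set \<Rightarrow> bool" where
  "contains_subgraph G F \<longleftrightarrow>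
     (\<exists>f. inj_on f (fst F) \<and> f ` fst F \<subseteq> fst G \<and> (\<forall>e\<in>snd F. f ` e \<in> snd G))"

definition complete_graph :: "nat \<Rightarrow> nat set \<times> nat set set" where
  "complete_graph t = ({..<t}, [{..<t}]\<^bsup>2\<^esup>)"

text \<open>
  Since every finite graph is isomorphic to one with vertices in \<open>nat\<close>, it suffices to range over
  those. The set below is finite, being bounded by \<open>n choose 2\<close>; when no admissible graph exists
  it is empty and the value of \<open>Max\<close> is unspecified. For fixed \<open>t \<ge> 3\<close> and \<open>\<delta> > 0\<close> this affects
  only finitely many terms of the sequence whose limit is taken further down.
\<close>

definition RT :: "nat \<Rightarrow> real \<Rightarrow> 'b set \<times> 'b set set \<Rightarrow> nat" where
  "RT n m F = Max {card E | (V :: nat set) E.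
     fin_graph V E \<and> card V = n \<and> \<not> contains_subgraph (V, E) F \<and> real (indep_number V E) < m}"

definition RT_ratio :: "nat \<Rightarrow> real \<Rightarrow> nat \<Rightarrow> real" where
  "RT_ratio t \<delta> n = real (RT n (\<delta> * real n) (complete_graph t)) / ((real n)\<^sup>2 / 2)"

text \<open>
  The value of \<open>lim\<close> is unspecified for a divergent sequence, so a claim about the value of
  \<open>RT_density\<close> has to be stated together with \<open>convergent\<close>.
\<close>

definition RT_density :: "nat \<Rightarrow> real \<Rightarrow> real" where
  "RT_density t \<delta> = lim (RT_ratio t \<delta>)"

end

theory Submission
  imports Defs
begin

text \<open>
  Upper bound. In a \<open>K\<^bsub>2r+1\<^esub>\<close>-free graph the common neighbourhood of a clique on \<open>2r - 1\<close>
  vertices spans no edge, so all but \<open>O(\<delta>n)\<close> vertices miss at least two vertices of any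
  \<open>K\<^bsub>2r\<^esub>\<close>. Hence the average degree over a maximal clique is at most \<open>(1 - 1/r + O(\<delta>))n\<close>,
  which already gives the bound up to a factor in front of \<open>\<delta>\<close>. If the minimum degree is
  close to \<open>(1 - 1/r)n\<close>, almost all vertices miss exactly two vertices of a fixed \<open>K\<^bsub>2r\<^esub>\<close>, and the
  pairs missed by many vertices turn out to form a perfect matching of it. This yields \<open>r\<close> parts
  that are almost completely joined to each other; they must be triangle-free, so every vertex has
  fewer than \<open>\<delta>n\<close> neighbours inside its own part.

  Lower bound. Take \<open>r\<close> copies of a triangle-free graph and join them completely. What is needed
  is a weighted triangle-free graph in which all weighted degrees are one and no stable set has weight
  more than one; if its total weight is \<open>x\<close>, then a blow-up realises the density
  \<open>(1 - 1/r) + 1/(rx)\<close>. From such a graph with total \<open>x\<close> one obtains another by adding layers of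
  copies of its vertices indexed by a cycle of length \<open>N\<close> and \<open>N\<close> further vertices, each joined to an
  arc of \<open>q\<close> layers. The case \<open>N = q = 1\<close> is the Mycielski construction, with total \<open>x + 1/x\<close>; letting
  \<open>q \<rightarrow> \<infinity>\<close> with \<open>N/q\<close> converging to a number between two and three, the totals fill the
  interval from \<open>x + 4/x\<close> to \<open>x + 6/(x + 2)\<close> densely. For \<open>x > 10\<close> these intervals overlap along the
  Mycielski iteration, so the attainable totals are dense in a half-line.
\<close>

section \<open>Simple graphs and maximal cliques\<close>

lemma sum_card_swap:
  assumes "finite A" "finite B"
  shows "(\<Sum>x\<in>A. card {y\<in>B. R x y}) = (\<Sum>y\<in>B. card {x\<in>A. R x y})"
proof -
  have "(\<Sum>x\<in>A. card {y\<in>B. R x y}) = (\<Sum>x\<in>A. \<Sum>y\<in>B. if R x y then 1 else 0)"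
    using assms by (simp add: sum.If_cases Int_def)
  also have "\<dots> = (\<Sum>y\<in>B. \<Sum>x\<in>A. if R x y then 1 else 0)"
    by (rule sum.swap)
  also have "\<dots> = (\<Sum>y\<in>B. card {x\<in>A. R x y})"
    using assms by (simp add: sum.If_cases Int_def)
  finally show ?thesis .
qed

definition stable :: "('a \<Rightarrow> 'a \<Rightarrow> bool) \<Rightarrow> 'a set \<Rightarrow> bool" where
  "stable adj A \<longleftrightarrow> (\<forall>u\<in>A. \<forall>v\<in>A. \<not> adj u v)"

locale simple_graph =
  fixes adj :: "'a \<Rightarrow> 'a \<Rightarrow> bool"
  assumes adj_sym: "adj u v \<Longrightarrow> adj v u" and adj_irrefl: "\<not> adj v v"
begin

definition nbrs :: "'a set \<Rightarrow> 'a \<Rightarrow> 'a set" where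
  "nbrs S v = {u\<in>S. adj v u}"

definition non_nbrs :: "'a set \<Rightarrow> 'a \<Rightarrow> 'a set" where
  "non_nbrs S v = {u\<in>S. \<not> adj v u}"

definition degree_sum :: "'a set \<Rightarrow> nat" where
  "degree_sum S = (\<Sum>v\<in>S. card (nbrs S v))"

lemma adj_commute: "adj u v \<longleftrightarrow> adj v u"
  using adj_sym by blast

lemma nbrs_subset: "nbrs S v \<subseteq> S" and non_nbrs_subset: "non_nbrs S v \<subseteq> S"
  by (auto simp: nbrs_def non_nbrs_def)

lemma finite_nbrs [simp]: "finite S \<Longrightarrow> finite (nbrs S v)"
  and finite_non_nbrs [simp]: "finite S \<Longrightarrow> finite (non_nbrs S v)"
  by (auto simp: nbrs_def non_nbrs_def)

lemma card_nbrs_plus_non_nbrs: "finite S \<Longrightarrow> card (nbrs S v) + card (non_nbrs S v) = card S"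
  by (subst card_Un_disjoint [symmetric])
     (auto simp: nbrs_def non_nbrs_def intro!: arg_cong [where f = card])

lemma sum_card_non_nbrs_swap:
  "finite A \<Longrightarrow> finite B \<Longrightarrow> (\<Sum>x\<in>A. card (non_nbrs B x)) = (\<Sum>y\<in>B. card (non_nbrs A y))"
  unfolding non_nbrs_def by (subst sum_card_swap) (simp_all add: adj_commute)

lemma clique_insert:
  "pairwise adj (insert x K) \<longleftrightarrow> pairwise adj K \<and> (\<forall>k\<in>K - {x}. adj x k)"
  using adj_sym by (auto simp: pairwise_insert)

lemma degree_sum_remove:
  assumes "finite S" "v \<in> S"
  shows "degree_sum S = degree_sum (S - {v}) + 2 * card (nbrs S v)"
proof -
  have 1: "card (nbrs S u) = card (nbrs (S - {v}) u) + (if adj u v then 1 else 0)" for u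
  proof (cases "adj u v")
    case True
    then have "nbrs S u = insert v (nbrs (S - {v}) u)"
      using assms by (auto simp: nbrs_def)
    then show ?thesis
      using True assms by (simp add: nbrs_def)
  next
    case False
    then have "nbrs S u = nbrs (S - {v}) u"
      by (auto simp: nbrs_def)
    then show ?thesis
      using False by simp
  qed
  have "degree_sum S = card (nbrs S v) + (\<Sum>u\<in>S - {v}. card (nbrs S u))"
    unfolding degree_sum_def using assms by (simp add: sum.remove)
  also have "(\<Sum>u\<in>S - {v}. card (nbrs S u))
      = degree_sum (S - {v}) + (\<Sum>u\<in>S - {v}. if adj u v then 1 else 0)"
    unfolding degree_sum_def by (subst 1) (simp add: sum.distrib)
  also have "(\<Sum>u\<in>S - {v}. if adj u v then 1 else 0) = card ((S - {v}) \<inter> {u. adj u v})"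
    using assms by (simp add: sum.If_cases)
  also have "(S - {v}) \<inter> {u. adj u v} = nbrs S v"
    using adj_irrefl adj_sym by (auto simp: nbrs_def)
  finally show ?thesis by simp
qed

text \<open>A set maximising \<open>degree_sum S - h |S|\<close> spans a graph with large minimum degree, since
  no single vertex may be worth deleting.\<close>

lemma exists_potential_maximizer:
  fixes h :: "nat \<Rightarrow> real"
  assumes "finite V"
  obtains S where "S \<subseteq> V" "real (degree_sum V) - h (card V) \<le> real (degree_sum S) - h (card S)"
    "real (degree_sum {}) - h 0 \<le> real (degree_sum S) - h (card S)"
    "\<And>v. v \<in> S \<Longrightarrow> 2 * real (card (nbrs S v)) \<ge> h (card S) - h (card S - 1)"
proof -
  let ?g = "\<lambda>S. real (degree_sum S) - h (card S)"
  have "\<exists>S\<in>Pow V. \<forall>T\<in>Pow V. ?g T \<le> ?g S"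
  proof -
    have "Max (?g ` Pow V) \<in> ?g ` Pow V"
      using assms by (intro Max_in) auto
    then obtain S where "S \<in> Pow V" "?g S = Max (?g ` Pow V)"
      by auto
    then show ?thesis
      using assms by (intro bexI [of _ S]) (auto intro!: Max_ge)
  qed
  then obtain S where S: "S \<subseteq> V" and max: "\<And>T. T \<subseteq> V \<Longrightarrow> ?g T \<le> ?g S"
    by auto
  have fin: "finite S"
    using S assms finite_subset by blast
  have "2 * real (card (nbrs S v)) \<ge> h (card S) - h (card S - 1)" if "v \<in> S" for v
  proof -
    have "S - {v} \<subseteq> V" and "card (S - {v}) = card S - 1"
      using S that fin by auto
    then show ?thesis
      using max [of "S - {v}"] degree_sum_remove [OF fin that] by simp
  qed
  then show ?thesis
    using that [of S] S max [of V] max [of "{}"] by auto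
qed

end

section \<open>Graphs without a clique on \<open>2 * r + 1\<close> vertices in which stable sets are
  smaller than \<open>a\<close>\<close>

locale clique_free_graph = simple_graph adj for adj :: "'a \<Rightarrow> 'a \<Rightarrow> bool" +
  fixes V :: "'a set" and r :: nat and a :: real
  assumes finite_V: "finite V" and r_pos: "r \<ge> 1"
    and no_clique: "K \<subseteq> V \<Longrightarrow> pairwise adj K \<Longrightarrow> card K \<noteq> 2 * r + 1"
    and stable_bound: "A \<subseteq> V \<Longrightarrow> stable adj A \<Longrightarrow> real (card A) < a"
begin

lemma clique_free_subgraph: "S \<subseteq> V \<Longrightarrow> clique_free_graph adj S r a"
  using no_clique stable_bound r_pos finite_V finite_subset
  by unfold_locales auto

lemma a_pos: "a > 0"
  using stable_bound [of "{}"] by (simp add: stable_def)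

lemma a_gt_1: "V \<noteq> {} \<Longrightarrow> a > 1"
  using stable_bound [of "{v}" for v] adj_irrefl by (fastforce simp: stable_def)

lemma clique_card_le:
  assumes "K \<subseteq> V" "pairwise adj K"
  shows "card K \<le> 2 * r"
proof (rule ccontr)
  assume "\<not> card K \<le> 2 * r"
  then obtain L where "L \<subseteq> K" "card L = 2 * r + 1"
    by (metis not_less_eq_eq obtain_subset_with_card_n Suc_eq_plus1)
  then show False
    using no_clique [of L] assms pairwise_subset by blast
qed

lemma edge_in_large_set:
  assumes "S \<subseteq> V" "real (card S) \<ge> a"
  obtains u v where "u \<in> S" "v \<in> S" "adj u v" "u \<noteq> v"
  using stable_bound [of S] assms adj_irrefl by (fastforce simp: stable_def)

text \<open>A vertex missing at most one vertex of \<open>K\<close> is adjacent to all of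
  \<open>K - {k}\<close> for some \<open>k\<close>. For fixed \<open>k\<close> these vertices form a
  stable set, since an edge among them together with \<open>K - {k}\<close> would be a clique with
  one vertex more than \<open>K\<close>. Members of \<open>K\<close> are included, as each misses
  itself.\<close>

lemma card_few_misses:
  assumes K: "K \<subseteq> V" "pairwise adj K" "K \<noteq> {}"
    and maximal: "\<And>L. L \<subseteq> V \<Longrightarrow> pairwise adj L \<Longrightarrow> card L \<noteq> Suc (card K)"
  shows "real (card {y\<in>V. card (non_nbrs K y) \<le> 1}) < card K * a"
proof -
  have finK: "finite K"
    using K finite_V finite_subset by blast
  let ?C = "\<lambda>k. {y\<in>V. \<forall>l\<in>K - {k}. adj y l}"
  have sub: "{y\<in>V. card (non_nbrs K y) \<le> 1} \<subseteq> (\<Union>k\<in>K. ?C k)"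
  proof
    fix y assume y: "y \<in> {y\<in>V. card (non_nbrs K y) \<le> 1}"
    have "\<exists>k\<in>K. non_nbrs K y \<subseteq> {k}"
    proof (cases "non_nbrs K y = {}")
      case True
      then show ?thesis using K by auto
    next
      case False
      then have "card (non_nbrs K y) = 1"
        using y finK by (simp add: le_Suc_eq)
      then show ?thesis
        using non_nbrs_subset [of K y] by (auto simp: card_1_singleton_iff)
    qed
    then show "y \<in> (\<Union>k\<in>K. ?C k)"
      using y by (auto simp: non_nbrs_def)
  qed
  have C: "real (card (?C k)) < a" if "k \<in> K" for k
  proof (rule stable_bound)
    show "stable adj (?C k)"
      unfolding stable_def
    proof (intro ballI notI)
      fix u v assume uv: "u \<in> ?C k" "v \<in> ?C k" "adj u v"
      let ?L = "insert u (insert v (K - {k}))"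
      have "u \<notin> K - {k}" "v \<notin> K - {k}" "u \<noteq> v"
        using uv adj_irrefl by auto
      then have "card ?L = Suc (card K)"
        using finK that by (simp add: card_Suc_Diff1 del: card_Diff_insert)
      moreover have "pairwise adj ?L"
        using uv K(2) by (auto simp: clique_insert intro: pairwise_subset)
      moreover have "?L \<subseteq> V"
        using uv K by auto
      ultimately show False
        using maximal by blast
    qed
  qed auto
  have "real (card {y\<in>V. card (non_nbrs K y) \<le> 1}) \<le> real (card (\<Union>k\<in>K. ?C k))"
    using sub finite_V finK by (intro of_nat_mono card_mono) auto
  also have "\<dots> \<le> (\<Sum>k\<in>K. real (card (?C k)))"
    using card_UN_le [OF finK, of ?C] by (simp flip: of_nat_sum)
  also have "\<dots> < (\<Sum>k\<in>K. a)"
    using finK K C by (intro sum_strict_mono) auto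
  finally show ?thesis by simp
qed

text \<open>Non-adjacent pairs between \<open>K\<close> and \<open>V\<close> are counted in two
  ways. Each vertex misses some vertex of \<open>K\<close>, because \<open>K\<close> cannot be
  enlarged, and all but fewer than \<open>card K * a\<close> vertices miss at least two.\<close>

lemma maximal_clique_degrees:
  assumes K: "K \<subseteq> V" "pairwise adj K" "K \<noteq> {}"
    and maximal: "\<And>L. L \<subseteq> V \<Longrightarrow> pairwise adj L \<Longrightarrow> card L \<noteq> Suc (card K)"
  shows "(\<Sum>k\<in>K. real (card (nbrs V k))) < (real (card K) - 2) * card V + card K * a"
proof -
  have finK: "finite K"
    using K finite_V finite_subset by blast
  let ?Y = "{y\<in>V. card (non_nbrs K y) \<le> 1}"
  have m: "real (card (non_nbrs K y)) \<ge> 2 - (if y \<in> ?Y then 1 else 0)" if "y \<in> V" for y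
  proof (cases "card (non_nbrs K y) = 0")
    case True
    then have all: "\<forall>k\<in>K. adj y k"
      using finK by (auto simp: non_nbrs_def)
    then have "y \<notin> K"
      using adj_irrefl by auto
    then have "card (insert y K) = Suc (card K)"
      using finK by simp
    moreover have "pairwise adj (insert y K)"
      using all K by (auto simp: clique_insert)
    ultimately show ?thesis
      using maximal [of "insert y K"] K that by auto
  qed (use that in auto)
  have "2 * real (card V) - card ?Y = (\<Sum>y\<in>V. 2 - (if y \<in> ?Y then 1 else 0))"
    using finite_V by (simp add: sum_subtractf sum.If_cases Int_def conj_commute) 
  also have "\<dots> \<le> (\<Sum>y\<in>V. real (card (non_nbrs K y)))"
    by (intro sum_mono m)
  also have "\<dots> = (\<Sum>k\<in>K. real (card (non_nbrs V k)))"
    using sum_card_non_nbrs_swap [OF finK finite_V] by (simp flip: of_nat_sum)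
  also have "\<dots> = (\<Sum>k\<in>K. real (card V) - real (card (nbrs V k)))"
    using card_nbrs_plus_non_nbrs [OF finite_V] by (intro sum.cong) (auto simp: algebra_simps simp flip: of_nat_add)
  also have "\<dots> = card K * real (card V) - (\<Sum>k\<in>K. real (card (nbrs V k)))"
    by (simp add: sum_subtractf)
  finally show ?thesis
    using card_few_misses [OF assms] by (simp add: algebra_simps)
qed

lemma exists_maximal_clique:
  assumes "V \<noteq> {}"
  obtains K where "K \<subseteq> V" "pairwise adj K" "K \<noteq> {}" "card K \<le> 2 * r"
    "\<And>L. L \<subseteq> V \<Longrightarrow> pairwise adj L \<Longrightarrow> card L \<le> card K"
proof -
  obtain v where v: "v \<in> V"
    using assms by auto
  let ?P = "\<lambda>K. K \<subseteq> V \<and> pairwise adj K"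
  have "\<exists>K. ?P K \<and> (\<forall>L. ?P L \<longrightarrow> card L \<le> card K)"
    using clique_card_le v
    by (intro ex_has_greatest_nat [of ?P "{v}" card "Suc (2 * r)"]) (auto simp: less_Suc_eq_le)
  then obtain K where K: "?P K" "\<And>L. ?P L \<Longrightarrow> card L \<le> card K"
    by blast
  have "card {v} \<le> card K"
    using v by (intro K) auto
  then have "K \<noteq> {}" by auto
  then show ?thesis
    using that K clique_card_le by blast
qed

lemma degree_sum_weak_bound:
  "real (degree_sum V) \<le> (1 - 1 / r) * (card V)\<^sup>2 + 4 * a * card V"
proof (rule ccontr)
  assume neg: "\<not> ?thesis"
  define c where "c = 1 - 1 / real r"
  have c: "0 \<le> c" "c \<le> 1"
    using r_pos by (auto simp: c_def field_simps)
  \<comment> \<open>Half the increment of \<open>h\<close> at \<open>m\<close> is at least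
    \<open>c * m + a\<close>; this \<open>a\<close> cancels the error term \<open>card K * a\<close>
    of \<open>maximal_clique_degrees\<close>. As \<open>a > 1\<close>, the linear term stays below
    \<open>4 * a * m\<close>.\<close>
  define h where "h m = c * (real m)\<^sup>2 + (2 * a + 2) * m" for m :: nat
  obtain S where S: "S \<subseteq> V"
    and max: "real (degree_sum V) - h (card V) \<le> real (degree_sum S) - h (card S)"
    and deg: "\<And>v. v \<in> S \<Longrightarrow> 2 * real (card (nbrs S v)) \<ge> h (card S) - h (card S - 1)"
    using exists_potential_maximizer [OF finite_V, of h] by metis
  have "V \<noteq> {}"
    using neg by (auto simp: degree_sum_def)
  then have "a > 1" by (rule a_gt_1)
  then have "(2 * a + 2) * card V \<le> 4 * a * card V"
    by (intro mult_right_mono) auto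
  then have "real (degree_sum V) - h (card V) > 0"
    using neg by (simp add: h_def c_def)
  then have "S \<noteq> {}"
    using max by (auto simp: degree_sum_def h_def)
  interpret S: clique_free_graph adj S r a
    by (rule clique_free_subgraph [OF S])
  obtain K where K: "K \<subseteq> S" "pairwise adj K" "K \<noteq> {}" "card K \<le> 2 * r"
      "\<And>L. L \<subseteq> S \<Longrightarrow> pairwise adj L \<Longrightarrow> card L \<le> card K"
    using S.exists_maximal_clique [OF \<open>S \<noteq> {}\<close>] by blast
  define m where "m = card S"
  have m: "m \<ge> 1"
    using \<open>S \<noteq> {}\<close> S.finite_V by (simp add: m_def Suc_le_eq card_gt_0_iff)
  have deg': "c * m + a \<le> card (nbrs S v)" if "v \<in> S" for v
  proof -
    have "h m - h (m - 1) = c * (2 * real m - 1) + (2 * a + 2)"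
      using m by (simp add: h_def of_nat_diff power2_eq_square algebra_simps)
    then show ?thesis
      using deg [OF that] c by (simp add: m_def algebra_simps)
  qed
  have "card K * (c * m + a) \<le> (\<Sum>k\<in>K. real (card (nbrs S k)))"
    using K deg' by (intro sum_bounded_below [where A = K, simplified]) auto
  also have "\<dots> < (real (card K) - 2) * m + card K * a"
    unfolding m_def
  proof (rule S.maximal_clique_degrees [OF K(1-3)])
    show "card L \<noteq> Suc (card K)" if "L \<subseteq> S" "pairwise adj L" for L
      using K(5) [OF that] by simp
  qed
  finally have "card K * c * m < (real (card K) - 2) * m"
    by (simp add: algebra_simps)
  \<comment> \<open>Since \<open>c = 1 - 1 / r\<close>, this says that \<open>card K / r\<close>
    exceeds two.\<close>
  then have "card K * c < real (card K) - 2"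
    using m by simp
  then have "2 * real r < card K"
    using r_pos by (simp add: c_def field_simps)
  then show False
    using K by linarith
qed

end

section \<open>Clique-free graphs of large minimum degree\<close>

locale dense_clique_free_graph = clique_free_graph +
  fixes \<kappa> :: real
  assumes \<kappa>_pos: "\<kappa> > 0" and \<kappa>_small: "1000 * real r ^ 4 * \<kappa> \<le> 1"
    and nonempty: "V \<noteq> {}" and a_le: "a \<le> \<kappa> * card V"
    and min_degree: "v \<in> V \<Longrightarrow> (1 - 1 / r - \<kappa>) * card V \<le> card (nbrs V v)"
begin

definition part_size :: real where
  "part_size = card V / r"

text \<open>Writing all error terms as numerical multiples of \<open>err 0 \<le> err 1 \<le> err 2 \<le> err 3\<close> keeps
  the estimates linear.\<close>

definition err :: "nat \<Rightarrow> real" where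
  "err i = real r ^ i * (\<kappa> * card V)"

lemma err_Suc: "err (Suc i) = r * err i"
  by (simp add: err_def)

lemma err_pos: "err i > 0"
  using \<kappa>_pos nonempty finite_V r_pos by (simp add: err_def card_gt_0_iff)

lemma err_mono: "i \<le> j \<Longrightarrow> err i \<le> err j"
  unfolding err_def using r_pos \<kappa>_pos by (intro mult_right_mono power_increasing) auto

lemma err_chain: "err 0 \<le> err 1" "err 1 \<le> err 2" "err 2 \<le> err 3"
  by (intro err_mono; simp)+

text \<open>Of the four powers of \<open>r\<close> in \<open>\<kappa>_small\<close>, three belong to
  \<open>err 3\<close> and one to the division in \<open>part_size\<close>.\<close>

lemma err_small: "1000 * err 3 \<le> part_size"
proof -
  have "1000 * real r ^ 4 * \<kappa> * card V \<le> 1 * real (card V)"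
    using \<kappa>_small by (intro mult_right_mono) auto
  then show ?thesis
    using r_pos by (simp add: err_def part_size_def field_simps eval_nat_numeral)
qed

lemma a_le_err: "a \<le> err 0"
  using a_le by (simp add: err_def)

lemma card_V_eq: "real (card V) = r * part_size"
  using r_pos by (simp add: part_size_def)

lemma card_non_nbrs_le: "v \<in> V \<Longrightarrow> card (non_nbrs V v) \<le> part_size + err 0"
  using min_degree [of v] card_nbrs_plus_non_nbrs [OF finite_V, of v]
  by (simp add: part_size_def err_def algebra_simps flip: of_nat_add)

text \<open>Over a largest clique, with \<open>s\<close> vertices, the average degree is at least
  about \<open>(1 - 1 / r) * card V\<close> but at most about \<open>(1 - 2 / s) * card V\<close>.
  The errors are too small to allow \<open>s \<le> 2 * r - 1\<close>.\<close>

lemma exists_full_clique: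
  obtains K where "K \<subseteq> V" "pairwise adj K" "card K = 2 * r"
proof -
  obtain K where K: "K \<subseteq> V" "pairwise adj K" "K \<noteq> {}" "card K \<le> 2 * r"
      "\<And>L. L \<subseteq> V \<Longrightarrow> pairwise adj L \<Longrightarrow> card L \<le> card K"
    using exists_maximal_clique [OF nonempty] by blast
  let ?s = "real (card K)" and ?n = "real (card V)"
  have n: "?n > 0"
    using nonempty finite_V by (simp add: card_gt_0_iff)
  have "?s * ((1 - 1 / r - \<kappa>) * ?n) \<le> (\<Sum>k\<in>K. real (card (nbrs V k)))"
    using K min_degree by (intro sum_bounded_below) auto
  also have "\<dots> < (?s - 2) * ?n + ?s * a"
  proof (rule maximal_clique_degrees [OF K(1-3)])
    show "card L \<noteq> Suc (card K)" if "L \<subseteq> V" "pairwise adj L" for L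
      using K(5) [OF that] by simp
  qed
  also have "\<dots> \<le> (?s - 2) * ?n + ?s * (\<kappa> * ?n)"
    using a_le by (intro add_left_mono mult_left_mono) auto
  finally have "2 * ?n < (?s / r + 2 * \<kappa> * ?s) * ?n"
    by (simp add: algebra_simps)
  then have 1: "2 < ?s / r + 2 * \<kappa> * ?s"
    using n by simp
  have "card K = 2 * r"
  proof (rule ccontr)
    assume "card K \<noteq> 2 * r"
    then have s: "?s \<le> 2 * real r - 1"
      using K(4) by linarith
    then have "?s / r \<le> 2 - 1 / r"
      using r_pos by (simp add: field_simps)
    moreover have "2 * \<kappa> * ?s \<le> 2 * \<kappa> * (2 * real r)"
      using s \<kappa>_pos by (intro mult_left_mono) auto
    ultimately have "1 / r < 4 * real r * \<kappa>"
      using 1 by (simp add: algebra_simps)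
    then have "1 < 4 * (real r)\<^sup>2 * \<kappa>"
      using r_pos by (simp add: field_simps power2_eq_square)
    also have "\<dots> \<le> 1000 * real r ^ 4 * \<kappa>"
      using r_pos \<kappa>_pos by (intro mult_right_mono mult_mono power_increasing) auto
    finally show False
      using \<kappa>_small by simp
  qed
  then show ?thesis
    using that K by blast
qed

section \<open>Cells of a clique on \<open>2 * r\<close> vertices and the parts they give rise
  to\<close>

definition cell :: "'a set \<Rightarrow> 'a set \<Rightarrow> 'a set" where
  "cell K \<pi> = {y\<in>V. non_nbrs K y = \<pi>}"

lemma cell_subset: "cell K \<pi> \<subseteq> V" and finite_cell [simp]: "finite (cell K \<pi>)"
  using finite_V by (auto simp: cell_def)

text \<open>By the degree condition the vertices of \<open>K\<close> are missed at most
  \<open>2 * card V + 2 * err 1\<close> times in total, so the average number of misses is hardly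
  above two. Hardly any vertex is below two by \<open>card_few_misses\<close>, hence few can be
  above.\<close>

lemma card_atypical:
  assumes K: "K \<subseteq> V" "pairwise adj K" "card K = 2 * r"
  shows "card {y\<in>V. card (non_nbrs K y) \<noteq> 2} \<le> 8 * err 1"
proof -
  have finK: "finite K" and "K \<noteq> {}"
    using K r_pos finite_V finite_subset by auto
  let ?Y = "{y\<in>V. card (non_nbrs K y) \<le> 1}" and ?X = "{y\<in>V. card (non_nbrs K y) \<noteq> 2}"
  have Y: "real (card ?Y) < card K * a"
    using K \<open>K \<noteq> {}\<close> no_clique by (intro card_few_misses) auto
  \<comment> \<open>The factor 3 keeps the summand nonpositive at a vertex with no misses or one
    miss. It leads to the constant \<open>8 = 2 + 3 * 2\<close>.\<close>
  have "2 * real (card V) + card ?X - 3 * card ?Y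
      = (\<Sum>y\<in>V. 2 + (if y \<in> ?X then 1 else 0) - 3 * (if y \<in> ?Y then 1 else 0))"
    using finite_V by (simp add: sum.distrib sum_subtractf sum.If_cases Int_def conj_commute
      flip: sum_distrib_left)
  also have "\<dots> \<le> (\<Sum>y\<in>V. real (card (non_nbrs K y)))"
    by (intro sum_mono) auto
  also have "\<dots> = (\<Sum>k\<in>K. real (card (non_nbrs V k)))"
    using sum_card_non_nbrs_swap [OF finK finite_V] by (simp flip: of_nat_sum)
  also have "\<dots> \<le> real (card K) * (part_size + err 0)"
    using K card_non_nbrs_le by (intro sum_bounded_above) auto
  finally have "2 * real (card V) + card ?X \<le> 2 * real r * (part_size + err 0) + 3 * (2 * real r * a)"
    using Y K by simp
  moreover have "real r * a \<le> real r * err 0"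
    using a_le_err by (intro mult_left_mono) auto
  ultimately show ?thesis
    using err_Suc [of 0] by (simp add: card_V_eq algebra_simps)
qed

lemma cell_disjoint_clique:
  assumes "pairwise adj K" "card \<pi> = 2" "y \<in> cell K \<pi>"
  shows "y \<notin> K"
proof
  assume "y \<in> K"
  then have "non_nbrs K y = {y}"
    using assms(1) adj_irrefl by (auto simp: non_nbrs_def pairwise_def)
  then have "card (non_nbrs K y) = 1"
    by simp
  then show False
    using assms by (auto simp: cell_def)
qed

lemma cell_adj: "y \<in> cell K \<pi> \<Longrightarrow> k \<in> K - \<pi> \<Longrightarrow> adj y k"
  by (auto simp: cell_def non_nbrs_def)

text \<open>Exchanging the pair \<open>\<pi>\<close> for an edge of its cell gives a new clique on
  \<open>2 * r\<close> vertices, to which \<open>card_atypical\<close> applies again; a triangle in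
  the cell would give a forbidden clique.\<close>

lemma clique_exchange:
  assumes K: "K \<subseteq> V" "pairwise adj K" "card K = 2 * r" and \<pi>: "\<pi> \<subseteq> K" "card \<pi> = 2"
    and C: "C \<subseteq> cell K \<pi>" "pairwise adj C"
  shows "C \<union> (K - \<pi>) \<subseteq> V" "pairwise adj (C \<union> (K - \<pi>))"
    "card (C \<union> (K - \<pi>)) + 2 = card C + 2 * r"
proof -
  have finK: "finite K"
    using K finite_V finite_subset by blast
  show "C \<union> (K - \<pi>) \<subseteq> V"
    using K C cell_subset by blast
  show "pairwise adj (C \<union> (K - \<pi>))"
    using K C cell_adj adj_sym unfolding pairwise_def by blast
  have "C \<inter> (K - \<pi>) = {}"
    using cell_disjoint_clique [OF K(2) \<pi>(2)] C by blast
  moreover have "finite C"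
    using C finite_cell finite_subset by blast
  moreover have "finite \<pi>"
    using finK \<pi> finite_subset by blast
  ultimately have "card (C \<union> (K - \<pi>)) = card C + (card K - card \<pi>)"
    using finK \<pi> by (simp add: card_Un_disjoint card_Diff_subset)
  then show "card (C \<union> (K - \<pi>)) + 2 = card C + 2 * r"
    using \<pi> K r_pos by simp
qed

lemma cell_nbrs_bound:
  assumes K: "K \<subseteq> V" "pairwise adj K" "card K = 2 * r" and \<pi>: "\<pi> \<subseteq> K" "card \<pi> = 2"
    and y: "y \<in> cell K \<pi>"
  shows "card (nbrs (cell K \<pi>) y) < a"
proof (rule stable_bound)
  show "nbrs (cell K \<pi>) y \<subseteq> V"
    using nbrs_subset cell_subset by blast
  show "stable adj (nbrs (cell K \<pi>) y)"
    unfolding stable_def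
  proof (intro ballI notI)
    fix u v assume uv: "u \<in> nbrs (cell K \<pi>) y" "v \<in> nbrs (cell K \<pi>) y" "adj u v"
    let ?C = "{y, u, v}"
    have "?C \<subseteq> cell K \<pi>" "pairwise adj ?C"
      using uv y by (auto simp: nbrs_def clique_insert)
    note L = clique_exchange [OF K \<pi> this]
    have "card ?C = 3"
      using uv adj_irrefl by (auto simp: nbrs_def card_insert_if)
    then show False
      using L no_clique by force
  qed
qed

text \<open>Let \<open>T\<close> be the large cell and \<open>C\<close> the other one. Almost every
  vertex of \<open>T\<close> is adjacent to exactly one end of any given edge inside
  \<open>C\<close>, while a vertex of \<open>C\<close> sees either fewer than \<open>a\<close> or
  almost all vertices of \<open>T\<close>. Hence adjacent vertices of \<open>C\<close> are of
  different kinds, so \<open>C\<close> is a union of two stable sets.\<close>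

lemma overlapping_cells:
  assumes K: "K \<subseteq> V" "pairwise adj K" "card K = 2 * r"
    and pqs: "p \<in> K" "q \<in> K" "s \<in> K" "p \<noteq> q" "p \<noteq> s" "q \<noteq> s"
    and big: "28 * err 1 < card (cell K {p, s})"
  shows "card (cell K {p, q}) \<le> 28 * err 1"
proof -
  define C where "C = cell K {p, q}"
  define T where "T = cell K {p, s}"
  have finT [simp]: "finite T" and TV: "T \<subseteq> V" and CV: "C \<subseteq> V" and finC: "finite C"
    by (simp_all add: C_def T_def cell_subset)
  have pq: "{p, q} \<subseteq> K" "card {p, q} = 2" and ps: "{p, s} \<subseteq> K" "card {p, s} = 2"
    using pqs by auto
  have T_adj: "adj w k" if "w \<in> T" "k \<in> K" "k \<noteq> p" "k \<noteq> s" for w k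
    using that cell_adj [of w K "{p, s}" k] by (auto simp: T_def)
  have T_nadj: "\<not> adj w s" if "w \<in> T" for w
    using that by (auto simp: T_def cell_def non_nbrs_def)
  have notK: "x \<notin> K" if "x \<in> C \<union> T" for x
    using that cell_disjoint_clique [OF K(2)] pq ps by (auto simp: C_def T_def)
  have CT: "C \<inter> T = {}"
    using pqs by (auto simp: C_def T_def cell_def)
  \<comment> \<open>After \<open>p\<close> and \<open>q\<close> are exchanged for \<open>y\<close>
    and \<open>z\<close>, a vertex of \<open>T\<close> misses \<open>s\<close> and otherwise at most
    \<open>y\<close> and \<open>z\<close>. It is atypical unless it misses exactly one of these
    two.\<close>
  have one: "card {w\<in>T. adj w y = adj w z} \<le> 8 * err 1"
    if yz: "y \<in> C" "z \<in> C" "adj y z" for y z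
  proof -
    let ?K = "{y, z} \<union> (K - {p, q})"
    have "y \<noteq> z"
      using yz adj_irrefl by auto
    then have K': "?K \<subseteq> V" "pairwise adj ?K" "card ?K = 2 * r"
      using clique_exchange [OF K pq, of "{y, z}"] yz by (auto simp: C_def clique_insert)
    have "card (non_nbrs ?K w) \<noteq> 2" if w: "w \<in> T" "adj w y = adj w z" for w
    proof (cases "adj w y")
      case True
      then have "non_nbrs ?K w = {s}"
        using w pqs T_adj [OF w(1)] T_nadj [OF w(1)] by (auto simp: non_nbrs_def)
      then show ?thesis by simp
    next
      case False
      then have "non_nbrs ?K w = {y, z, s}"
        using w pqs T_adj [OF w(1)] T_nadj [OF w(1)] by (auto simp: non_nbrs_def)
      then show ?thesis
        using \<open>y \<noteq> z\<close> notK [of y] notK [of z] yz pqs by (auto simp: card_insert_if)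
    qed
    then have "{w\<in>T. adj w y = adj w z} \<subseteq> {y\<in>V. card (non_nbrs ?K y) \<noteq> 2}"
      using TV by auto
    then have "card {w\<in>T. adj w y = adj w z} \<le> card {y\<in>V. card (non_nbrs ?K y) \<noteq> 2}"
      using finite_V by (intro card_mono) auto
    then show ?thesis
      using card_atypical [OF K'] by linarith
  qed
  \<comment> \<open>First \<open>p\<close> and \<open>s\<close> are exchanged for an edge
    \<open>uv\<close> in the neighbourhood of \<open>y\<close>, then \<open>q\<close> for
    \<open>y\<close>. A vertex of \<open>T\<close> missing \<open>y\<close>, \<open>u\<close> and
    \<open>v\<close> is atypical for the resulting clique; every other non-neighbour of
    \<open>y\<close> in \<open>T\<close> is one of the fewer than \<open>2 * a\<close> neighbours of
    \<open>u\<close> or \<open>v\<close>.\<close>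
  have many: "card (non_nbrs T y) \<le> 10 * err 1"
    if y: "y \<in> C" and yT: "card (nbrs T y) \<ge> a" for y
  proof -
    obtain u v where uv: "u \<in> nbrs T y" "v \<in> nbrs T y" "adj u v" "u \<noteq> v"
      using edge_in_large_set [OF _ yT] TV nbrs_subset by blast
    then have uvT: "u \<in> T" "v \<in> T" "adj y u" "adj y v"
      by (auto simp: nbrs_def)
    let ?L = "{u, v} \<union> (K - {p, s})"
    let ?K = "insert y (?L - {q})"
    have L: "?L \<subseteq> V" "pairwise adj ?L" "card ?L = 2 * r"
      using clique_exchange [OF K ps, of "{u, v}"] uv uvT by (auto simp: T_def clique_insert)
    have y_adj: "\<forall>k\<in>?L - {q}. adj y k"
      using uvT y cell_adj [of y K "{p, q}"] by (auto simp: C_def)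
    have "y \<notin> ?L"
      using uvT y CT notK [of y] by auto
    moreover have "q \<in> ?L" "finite ?L"
      using pqs finite_subset [OF L(1) finite_V] by auto
    ultimately have "card ?K = card ?L"
      by (subst card_insert_disjoint) (auto simp only: card_Suc_Diff1 finite_Diff Diff_iff)
    then have "card ?K = 2 * r"
      using L(3) by simp
    moreover have "pairwise adj ?K"
      using y_adj pairwise_subset [OF L(2) Diff_subset [of ?L "{q}"]] clique_insert by blast
    moreover have "?K \<subseteq> V"
      using L(1) y CV by blast
    ultimately have atyp: "card {w\<in>V. card (non_nbrs ?K w) \<noteq> 2} \<le> 8 * err 1"
      using card_atypical by blast
    have "card (non_nbrs ?K w) \<noteq> 2"
      if w: "w \<in> T" "\<not> adj y w" "\<not> adj u w" "\<not> adj v w" for w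
    proof -
      have "non_nbrs ?K w = {y, u, v}"
        using w pqs T_adj [OF w(1)] notK [of u] notK [of v] uvT adj_sym
        by (auto simp: non_nbrs_def)
      moreover have "y \<noteq> u" "y \<noteq> v"
        using uvT adj_irrefl by auto
      ultimately show ?thesis
        using uv by simp
    qed
    then have "non_nbrs T y \<subseteq> {w\<in>V. card (non_nbrs ?K w) \<noteq> 2} \<union> nbrs T u \<union> nbrs T v"
      using TV by (auto simp: non_nbrs_def nbrs_def)
    then have "card (non_nbrs T y)
        \<le> card ({w\<in>V. card (non_nbrs ?K w) \<noteq> 2} \<union> nbrs T u \<union> nbrs T v)"
      using finite_V by (intro card_mono) auto
    also have "\<dots> \<le> card {w\<in>V. card (non_nbrs ?K w) \<noteq> 2} + card (nbrs T u) + card (nbrs T v)"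
      by (meson add_le_mono1 card_Un_le le_trans)
    finally have "real (card (non_nbrs T y)) \<le> 8 * err 1 + card (nbrs T u) + card (nbrs T v)"
      using atyp by linarith
    moreover have "card (nbrs T u) < a" "card (nbrs T v) < a"
      using cell_nbrs_bound [OF K ps] uvT by (simp_all add: T_def)
    ultimately show ?thesis
      using a_le_err err_chain by linarith
  qed
  define F where "F = {y\<in>C. card (nbrs T y) \<ge> a}"
  \<comment> \<open>The three sets that would cover \<open>T\<close> have at most
    \<open>(10 + 10 + 8) * err 1\<close> elements altogether; this is the origin of the constant
    28.\<close>
  have "stable adj F"
    unfolding stable_def
  proof (intro ballI notI)
    fix y z assume yz: "y \<in> F" "z \<in> F" "adj y z"
    have "T \<subseteq> non_nbrs T y \<union> non_nbrs T z \<union> {w\<in>T. adj w y = adj w z}"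
      using adj_sym by (auto simp: non_nbrs_def)
    then have "card T \<le> card (non_nbrs T y \<union> non_nbrs T z \<union> {w\<in>T. adj w y = adj w z})"
      by (intro card_mono) auto
    also have "\<dots> \<le> card (non_nbrs T y) + card (non_nbrs T z) + card {w\<in>T. adj w y = adj w z}"
      by (meson add_le_mono1 card_Un_le le_trans)
    finally show False
      using many [of y] many [of z] one [of y z] yz big
      by (simp add: F_def T_def)
  qed
  moreover have "stable adj (C - F)"
    unfolding stable_def
  proof (intro ballI notI)
    fix y z assume yz: "y \<in> C - F" "z \<in> C - F" "adj y z"
    have "T \<subseteq> nbrs T y \<union> nbrs T z \<union> {w\<in>T. adj w y = adj w z}"
      using adj_sym by (auto simp: nbrs_def)
    then have "card T \<le> card (nbrs T y \<union> nbrs T z \<union> {w\<in>T. adj w y = adj w z})"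
      by (intro card_mono) auto
    also have "\<dots> \<le> card (nbrs T y) + card (nbrs T z) + card {w\<in>T. adj w y = adj w z}"
      by (meson add_le_mono1 card_Un_le le_trans)
    finally have "real (card T) \<le> card (nbrs T y) + card (nbrs T z) + card {w\<in>T. adj w y = adj w z}"
      by (simp flip: of_nat_add)
    moreover have "card (nbrs T y) < a" "card (nbrs T z) < a" and "28 * err 1 < card T"
      using yz big by (auto simp: F_def T_def)
    moreover have "card {w\<in>T. adj w y = adj w z} \<le> 8 * err 1"
      using one [of y z] yz by auto
    ultimately show False
      using a_le_err err_chain err_pos [of 1] by linarith
  qed
  ultimately have "card F < a" "card (C - F) < a"
    using CV by (auto simp: F_def intro!: stable_bound)
  moreover have "card C = card F + card (C - F)"
    using finC by (subst card_Un_disjoint [symmetric]) (auto simp: F_def intro!: arg_cong [where f = card])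
  ultimately show ?thesis
    using a_le_err err_chain err_pos [of 1] by (simp add: C_def)
qed

text \<open>All vertices of \<open>K\<close> together are missed almost \<open>2 * card V\<close>
  times, and none of them more than \<open>part_size + err 0\<close> times, so \<open>k\<close> is
  missed almost \<open>part_size\<close> times. Up to atypical vertices, its non-neighbours are
  spread over the cells of the pairs \<open>{k, q}\<close>, of which only one can be large.\<close>

lemma exists_mate:
  assumes K: "K \<subseteq> V" "pairwise adj K" "card K = 2 * r" and k: "k \<in> K"
  obtains q where "q \<in> K" "q \<noteq> k" "card (cell K {k, q}) > 28 * err 1"
    "card (cell K {k, q}) \<ge> part_size - 56 * err 2"
proof -
  have finK: "finite K"
    using K(1) finite_V finite_subset by blast
  let ?X = "{y\<in>V. card (non_nbrs K y) \<noteq> 2}"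
  let ?miss = "\<lambda>l. real (card (non_nbrs V l))"
  have X: "card ?X \<le> 8 * err 1"
    using card_atypical [OF K] .
  have "2 * real (card V) - 2 * card ?X \<le> (\<Sum>y\<in>V. 2 - 2 * (if y \<in> ?X then 1 else 0))"
    using finite_V by (simp add: sum_subtractf sum.If_cases Int_def conj_commute
      flip: sum_distrib_left)
  also have "\<dots> \<le> (\<Sum>y\<in>V. real (card (non_nbrs K y)))"
    by (intro sum_mono) auto
  also have "\<dots> = (\<Sum>l\<in>K. ?miss l)"
    using sum_card_non_nbrs_swap [OF finK finite_V] by (simp flip: of_nat_sum)
  also have "\<dots> = ?miss k + (\<Sum>l\<in>K - {k}. ?miss l)"
    using finK k by (simp add: sum.remove)
  also have "(\<Sum>l\<in>K - {k}. ?miss l) \<le> real (card (K - {k})) * (part_size + err 0)"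
    using K card_non_nbrs_le by (intro sum_bounded_above) auto
  also have "real (card (K - {k})) = 2 * real r - 1"
    using k K finK r_pos by (simp add: of_nat_diff)
  finally have miss_k: "?miss k \<ge> part_size - 18 * err 1"
    using X err_Suc [of 0] err_pos [of 0] by (simp add: card_V_eq algebra_simps)
  have "non_nbrs V k \<subseteq> ?X \<union> (\<Union>q\<in>K - {k}. cell K {k, q})"
  proof
    fix y assume y: "y \<in> non_nbrs V k"
    show "y \<in> ?X \<union> (\<Union>q\<in>K - {k}. cell K {k, q})"
    proof (cases "y \<in> ?X")
      case False
      then obtain u v where uv: "non_nbrs K y = {u, v}" "u \<noteq> v"
        using y by (auto simp: non_nbrs_def card_2_iff)
      moreover have "k \<in> non_nbrs K y" "u \<in> K" "v \<in> K"
        using y k uv non_nbrs_subset [of K y] adj_sym by (auto simp: non_nbrs_def)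
      ultimately have "\<exists>q\<in>K - {k}. non_nbrs K y = {k, q}"
        by (auto simp: insert_commute)
      then show ?thesis
        using y by (auto simp: cell_def non_nbrs_def)
    qed simp
  qed
  then have "card (non_nbrs V k) \<le> card (?X \<union> (\<Union>q\<in>K - {k}. cell K {k, q}))"
    using finite_V finK by (intro card_mono) auto
  also have "\<dots> \<le> card ?X + card (\<Union>q\<in>K - {k}. cell K {k, q})"
    by (rule card_Un_le)
  also have "\<dots> \<le> card ?X + (\<Sum>q\<in>K - {k}. card (cell K {k, q}))"
    using finK by (intro add_left_mono card_UN_le) auto
  finally have "?miss k \<le> card ?X + (\<Sum>q\<in>K - {k}. real (card (cell K {k, q})))"
    by (simp flip: of_nat_sum of_nat_add)
  then have cells: "(\<Sum>q\<in>K - {k}. real (card (cell K {k, q}))) \<ge> part_size - 26 * err 1"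
    using miss_k X by linarith
  have e2: "real r * err 1 = err 2"
    using err_Suc [of 1] by (simp add: numeral_2_eq_2)
  have card_Kk: "real (card (K - {k})) = 2 * real r - 1"
    using k K finK r_pos by (simp add: of_nat_diff)
  have "\<exists>q\<in>K - {k}. card (cell K {k, q}) > 28 * err 1"
  proof (rule ccontr)
    assume "\<not> ?thesis"
    then have "(\<Sum>q\<in>K - {k}. real (card (cell K {k, q}))) \<le> real (card (K - {k})) * (28 * err 1)"
      by (intro sum_bounded_above) (auto simp: not_less)
    then have "part_size - 26 * err 1 \<le> 56 * err 2 - 28 * err 1"
      using cells e2 by (simp add: card_Kk algebra_simps)
    then show False
      using err_small err_chain err_pos [of 1] by linarith
  qed
  then obtain q where q: "q \<in> K" "q \<noteq> k" and big: "card (cell K {k, q}) > 28 * err 1"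
    by auto
  \<comment> \<open>The other \<open>2 * r - 2\<close> cells at \<open>k\<close> contribute at most
    \<open>56 * err 2 - 56 * err 1\<close>; the negative term makes up for the loss of
    \<open>26 * err 1\<close> in \<open>cells\<close>.\<close>
  have "card (cell K {k, l}) \<le> 28 * err 1" if "l \<in> K - {k} - {q}" for l
    using overlapping_cells [OF K k, of l q] that q big by auto
  then have "(\<Sum>l\<in>K - {k} - {q}. real (card (cell K {k, l})))
      \<le> real (card (K - {k} - {q})) * (28 * err 1)"
    by (intro sum_bounded_above) auto
  also have "real (card (K - {k} - {q})) = 2 * real r - 2"
    using k q K finK r_pos by (simp add: card_Diff_singleton_if of_nat_diff)
  finally have "(\<Sum>l\<in>K - {k}. real (card (cell K {k, l})))
      \<le> card (cell K {k, q}) + (2 * real r - 2) * (28 * err 1)"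
    using q finK by (simp add: sum.remove [of "K - {k}" q])
  then have "card (cell K {k, q}) \<ge> part_size - 56 * err 2"
    using cells e2 err_pos [of 1] by (simp add: algebra_simps)
  then show ?thesis
    using that q big by blast
qed

text \<open>The parts need not cover \<open>V\<close>; up to \<open>56 * err 3\<close> vertices may
  be left over.\<close>

definition good_partition :: "'a set set \<Rightarrow> bool" where
  "good_partition P \<longleftrightarrow> card P = r \<and> pairwise disjnt P \<and>
     (\<forall>U\<in>P. U \<subseteq> V \<and> part_size - 56 * err 2 \<le> card U \<and> (\<forall>v\<in>U. card (nbrs U v) < a))"

text \<open>Each vertex of \<open>K\<close> lies in a heavy pair by \<open>exists_mate\<close> and
  in only one by \<open>overlapping_cells\<close>. So the heavy pairs are \<open>r\<close> disjoint
  pairs, and their cells serve as parts.\<close>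

lemma exists_good_partition: "\<exists>P. good_partition P"
proof -
  obtain K where K: "K \<subseteq> V" "pairwise adj K" "card K = 2 * r"
    by (rule exists_full_clique)
  have finK: "finite K"
    using K(1) finite_V finite_subset by blast
  define \<M> where "\<M> = {{p, q} | p q. p \<in> K \<and> q \<in> K \<and> p \<noteq> q \<and> card (cell K {p, q}) > 28 * err 1}"
  have \<M>: "\<pi> \<subseteq> K" "card \<pi> = 2" "card (cell K \<pi>) > 28 * err 1" if "\<pi> \<in> \<M>" for \<pi>
    using that by (auto simp: \<M>_def)
  have unique: "q = q'" if "p \<in> K" "q \<in> K" "q' \<in> K" "p \<noteq> q" "p \<noteq> q'"
     "card (cell K {p, q}) > 28 * err 1" "card (cell K {p, q'}) > 28 * err 1" for p q q'
    using overlapping_cells [OF K, of p q q'] that by fastforce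
  have disj: "\<pi> \<inter> \<rho> = {}" if "\<pi> \<in> \<M>" "\<rho> \<in> \<M>" "\<pi> \<noteq> \<rho>" for \<pi> \<rho>
  proof (rule ccontr)
    assume "\<pi> \<inter> \<rho> \<noteq> {}"
    then obtain p where p: "p \<in> \<pi>" "p \<in> \<rho>" by auto
    have "\<exists>q\<in>K. q \<noteq> p \<and> \<sigma> = {p, q} \<and> card (cell K {p, q}) > 28 * err 1"
      if "\<sigma> \<in> \<M>" "p \<in> \<sigma>" for \<sigma>
      using that by (auto simp: \<M>_def insert_commute)
    from this [OF that(1) p(1)] this [OF that(2) p(2)] show False
      using unique [of p] \<M>(1) p that by blast
  qed
  have covers: "\<Union>\<M> = K"
  proof
    show "K \<subseteq> \<Union>\<M>"
    proof
      fix k assume k: "k \<in> K"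
      obtain q where "q \<in> K" "q \<noteq> k" "card (cell K {k, q}) > 28 * err 1"
        using exists_mate [OF K k] by metis
      then have "{k, q} \<in> \<M>"
        using k by (auto simp: \<M>_def)
      then show "k \<in> \<Union>\<M>" by blast
    qed
  qed (use \<M> in blast)
  have fin\<M>: "finite \<M>"
    using finK covers by (metis finite_UnionD)
  have "2 * card \<M> = card (\<Union>\<M>)"
    using fin\<M> finK covers \<M> disj by (intro card_partition) auto
  then have card\<M>: "card \<M> = r"
    using K covers by simp
  have cell_disj: "cell K \<pi> \<inter> cell K \<rho> = {}" if "\<pi> \<noteq> \<rho>" for \<pi> \<rho>
    using that by (auto simp: cell_def)
  have inj: "inj_on (cell K) \<M>"
  proof (rule inj_onI)
    fix \<pi> \<rho> assume "\<pi> \<in> \<M>" "\<rho> \<in> \<M>" "cell K \<pi> = cell K \<rho>"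
    moreover have "cell K \<pi> \<noteq> {}"
      using \<M>(3) [of \<pi>] err_pos [of 1] \<open>\<pi> \<in> \<M>\<close> by (intro notI) simp
    ultimately show "\<pi> = \<rho>"
      using cell_disj by blast
  qed
  have "good_partition (cell K ` \<M>)"
    unfolding good_partition_def
  proof (intro conjI ballI)
    show "card (cell K ` \<M>) = r"
      using inj card\<M> by (simp add: card_image)
    show "pairwise disjnt (cell K ` \<M>)"
      by (rule pairwise_imageI) (simp add: disjnt_def cell_disj)
    fix U assume "U \<in> cell K ` \<M>"
    then obtain \<pi> where \<pi>: "\<pi> \<in> \<M>" "U = cell K \<pi>" by auto
    show "U \<subseteq> V"
      using \<pi> cell_subset by simp
    show "card (nbrs U v) < a" if "v \<in> U" for v
      using cell_nbrs_bound [OF K \<M>(1,2)] \<pi> that by simp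
    obtain p q where pq: "\<pi> = {p, q}" "p \<in> K" "q \<in> K" "p \<noteq> q" "card (cell K {p, q}) > 28 * err 1"
      using \<pi>(1) by (auto simp: \<M>_def)
    obtain q' where q': "q' \<in> K" "q' \<noteq> p" "card (cell K {p, q'}) > 28 * err 1"
      "card (cell K {p, q'}) \<ge> part_size - 56 * err 2"
      using exists_mate [OF K pq(2)] by metis
    then have "q' = q"
      using unique [of p q' q] pq by auto
    then show "part_size - 56 * err 2 \<le> card U"
      using q' \<pi> pq by simp
  qed
  then show ?thesis by blast
qed

text \<open>Nearly all of the at most \<open>part_size + err 0\<close> non-neighbours of
  \<open>v\<close> are already used up inside \<open>U\<close>, where \<open>v\<close> has fewer
  than \<open>a\<close> neighbours.\<close>

lemma part_non_nbrs:
  assumes P: "good_partition P" and U: "U \<in> P" "U' \<in> P" "U \<noteq> U'" and v: "v \<in> U"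
  shows "card (non_nbrs U' v) \<le> 58 * err 2"
proof -
  have UV: "U \<subseteq> V" "U' \<subseteq> V" "U \<inter> U' = {}" and nbrs: "card (nbrs U v) < a"
    and size: "part_size - 56 * err 2 \<le> card U"
    using P U v by (auto simp: good_partition_def pairwise_def disjnt_def)
  have fin: "finite U" "finite U'"
    using UV finite_V by (auto intro: finite_subset)
  have "card (non_nbrs U v) + card (non_nbrs U' v) = card (non_nbrs U v \<union> non_nbrs U' v)"
    using UV fin by (intro card_Un_disjoint [symmetric]) (auto simp: non_nbrs_def)
  also have "\<dots> \<le> card (non_nbrs V v)"
    using UV finite_V by (intro card_mono) (auto simp: non_nbrs_def)
  finally have "real (card (non_nbrs U v)) + card (non_nbrs U' v) \<le> part_size + err 0"
    using card_non_nbrs_le [of v] v UV by fastforce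
  moreover have "real (card (nbrs U v)) + card (non_nbrs U v) = card U"
    using card_nbrs_plus_non_nbrs [OF fin(1)] by (simp flip: of_nat_add)
  ultimately show ?thesis
    using size nbrs a_le_err err_chain by linarith
qed

text \<open>Greedy embedding: an edge is chosen in each of the given parts, always inside the common
  neighbourhood of the clique built so far.\<close>

lemma extend_clique:
  assumes P: "good_partition P" and "finite R" "R \<subseteq> P"
    and "K \<subseteq> V" "finite K" "pairwise adj K"
    and "\<And>U. U \<in> R \<Longrightarrow> card {u\<in>U. \<forall>k\<in>K. adj k u} \<ge> 116 * err 2 * card R + a"
  shows "\<exists>L\<subseteq>V. pairwise adj L \<and> card L = card K + 2 * card R"
  using assms(2-)
proof (induction R arbitrary: K rule: finite_induct)
  case empty
  then show ?case by auto
next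
  case (insert U R)
  let ?N = "\<lambda>K U. {u\<in>U. \<forall>k\<in>K. adj k u}"
  have "U \<subseteq> V"
    using P insert.prems by (auto simp: good_partition_def)
  then have NV: "?N K U \<subseteq> V" by auto
  have "116 * err 2 * card (insert U R) \<ge> 0"
    using err_pos [of 2] by (intro mult_nonneg_nonneg) auto
  then have "card (?N K U) \<ge> a"
    using insert.prems(5) [OF insertI1] by linarith
  then obtain x y where xy: "x \<in> ?N K U" "y \<in> ?N K U" "adj x y" "x \<noteq> y"
    using edge_in_large_set [OF NV] by blast
  let ?K = "insert x (insert y K)"
  have K: "?K \<subseteq> V" "finite ?K"
    using insert.prems xy NV by auto
  have clq: "pairwise adj ?K"
    using insert.prems(4) xy adj_sym by (auto simp: clique_insert)
  have card: "card ?K = card K + 2"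
    using insert.prems(3) xy adj_irrefl by (auto simp: card_insert_if)
  \<comment> \<open>Each of \<open>x\<close> and \<open>y\<close> removes at most
    \<open>58 * err 2\<close> vertices from the remaining candidates in \<open>W\<close>, which
    explains the amount \<open>116 * err 2\<close> per part.\<close>
  have "card (?N ?K W) \<ge> 116 * err 2 * card R + a" if W: "W \<in> R" for W
  proof -
    have "W \<subseteq> V" "U \<noteq> W"
      using P W insert.prems insert.hyps by (auto simp: good_partition_def)
    then have "finite W"
      using finite_V by (auto intro: finite_subset)
    have non: "card (non_nbrs W z) \<le> 58 * err 2" if "z \<in> U" for z
      using part_non_nbrs [OF P, of U W z] that W insert.prems \<open>U \<noteq> W\<close> by auto
    have "?N K W \<subseteq> ?N ?K W \<union> non_nbrs W x \<union> non_nbrs W y"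
      by (auto simp: non_nbrs_def)
    then have "card (?N K W) \<le> card (?N ?K W \<union> non_nbrs W x \<union> non_nbrs W y)"
      using \<open>finite W\<close> by (intro card_mono) auto
    also have "\<dots> \<le> card (?N ?K W) + card (non_nbrs W x) + card (non_nbrs W y)"
      by (meson add_le_mono1 card_Un_le le_trans)
    finally have "card (?N K W) \<le> card (?N ?K W) + 116 * err 2"
      using non [of x] non [of y] xy by simp
    moreover have "116 * err 2 * card (insert U R) + a \<le> card (?N K W)"
      using insert.prems(5) W by blast
    ultimately show ?thesis
      using insert.hyps by (simp add: algebra_simps)
  qed
  then obtain L where "L \<subseteq> V" "pairwise adj L" "card L = card ?K + 2 * card R"
    using insert.IH [OF _ K clq] insert.prems by blast
  then show ?case
    using card insert.hyps by auto
qed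

lemma dense_degree_sum_bound:
  "real (degree_sum V) \<le> (1 - 1 / r) * (real (card V))\<^sup>2 + a * card V"
proof -
  obtain P where P: "good_partition P"
    using exists_good_partition by blast
  then have card_P: "card P = r" and PV: "\<And>U. U \<in> P \<Longrightarrow> U \<subseteq> V"
    and P_size: "\<And>U. U \<in> P \<Longrightarrow> part_size - 56 * err 2 \<le> card U"
    by (auto simp: good_partition_def)
  have finP: "finite P"
    using card_P r_pos card.infinite by fastforce
  have finU: "finite U" if "U \<in> P" for U
    using PV [OF that] finite_V finite_subset by blast
  have e3: "err 2 * real r = err 3"
    using err_Suc [of 2] by (simp add: numeral_3_eq_3)
  \<comment> \<open>Otherwise \<open>v\<close> could be extended by an edge from each of the
    \<open>r\<close> parts to a clique on \<open>2 * r + 1\<close> vertices. The excess of 117 over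
    116 makes room for \<open>a\<close>.\<close>
  have "\<exists>U\<in>P. card (nbrs U v) < 117 * err 3" if v: "v \<in> V" for v
  proof (rule ccontr)
    assume "\<not> ?thesis"
    then have all: "card (nbrs U v) \<ge> 117 * err 3" if "U \<in> P" for U
      using that by force
    have "card {u\<in>U. \<forall>k\<in>{v}. adj k u} \<ge> 116 * err 2 * card P + a" if "U \<in> P" for U
    proof -
      have "{u\<in>U. \<forall>k\<in>{v}. adj k u} = nbrs U v"
        by (auto simp: nbrs_def)
      then show ?thesis
        using all [OF that] e3 a_le_err err_chain card_P by simp
    qed
    then obtain L where "L \<subseteq> V" "pairwise adj L" "card L = card {v} + 2 * card P"
      using extend_clique [OF P finP, of "{v}"] v by auto
    then show False
      using no_clique [of L] card_P by simp
  qed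
  then obtain f where f: "\<And>v. v \<in> V \<Longrightarrow> f v \<in> P" "\<And>v. v \<in> V \<Longrightarrow> card (nbrs (f v) v) < 117 * err 3"
    by metis
  have non: "card (non_nbrs U v) \<le> 174 * err 3" if v: "v \<in> V" and U: "U \<in> P" "U \<noteq> f v" for v U
  proof -
    have sub: "f v \<subseteq> V" "U \<subseteq> V" "f v \<inter> U = {}"
      using P U f [OF v] by (auto simp: good_partition_def pairwise_def disjnt_def)
    have "card (non_nbrs (f v) v) + card (non_nbrs U v) = card (non_nbrs (f v) v \<union> non_nbrs U v)"
      using sub finU f v U by (intro card_Un_disjoint [symmetric]) (auto simp: non_nbrs_def)
    also have "\<dots> \<le> card (non_nbrs V v)"
      using sub finite_V by (intro card_mono) (auto simp: non_nbrs_def)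
    finally have "real (card (non_nbrs (f v) v)) + card (non_nbrs U v) \<le> part_size + err 0"
      using card_non_nbrs_le [OF v] by linarith
    moreover have "real (card (nbrs (f v) v)) + card (non_nbrs (f v) v) = card (f v)"
      using card_nbrs_plus_non_nbrs [OF finU [OF f(1) [OF v]]] by (simp flip: of_nat_add)
    ultimately show ?thesis
      using P_size [OF f(1) [OF v]] f(2) [OF v] err_chain by linarith
  qed
  \<comment> \<open>Every vertex is assigned to a part in which it has few neighbours. Unlike the
    parts themselves, the classes \<open>W U\<close> cover \<open>V\<close>.\<close>
  define W where "W U = {v\<in>V. f v = U}" for U
  have WV: "W U \<subseteq> V" and finW: "finite (W U)" for U
    using finite_V by (auto simp: W_def)
  \<comment> \<open>A triangle inside one class, extended by an edge from each of the other
    \<open>r - 1\<close> parts, would be a clique on \<open>3 + 2 * (r - 1) = 2 * r + 1\<close>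
    vertices.\<close>
  have inner: "card (nbrs (W (f v)) v) < a" if v: "v \<in> V" for v
  proof (rule stable_bound)
    show "nbrs (W (f v)) v \<subseteq> V"
      using nbrs_subset WV by blast
    show "stable adj (nbrs (W (f v)) v)"
      unfolding stable_def
    proof (intro ballI notI)
      fix x y assume xy: "x \<in> nbrs (W (f v)) v" "y \<in> nbrs (W (f v)) v" "adj x y"
      let ?K = "{v, x, y}"
      have K: "?K \<subseteq> V" "pairwise adj ?K" "finite ?K" and same: "f x = f v" "f y = f v"
        using xy v by (auto simp: nbrs_def W_def clique_insert)
      have card_K: "card ?K = 3"
        using xy adj_irrefl by (auto simp: nbrs_def card_insert_if)
      have card_R: "card (P - {f v}) = r - 1"
        using f(1) [OF v] card_P finP by simp
      have "card {u\<in>U. \<forall>k\<in>?K. adj k u} \<ge> 116 * err 2 * card (P - {f v}) + a"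
        if U: "U \<in> P - {f v}" for U
      proof -
        have "U \<subseteq> {u\<in>U. \<forall>k\<in>?K. adj k u} \<union> non_nbrs U v \<union> non_nbrs U x \<union> non_nbrs U y"
          by (auto simp: non_nbrs_def)
        then have "card U
            \<le> card ({u\<in>U. \<forall>k\<in>?K. adj k u} \<union> non_nbrs U v \<union> non_nbrs U x \<union> non_nbrs U y)"
          using finU U by (intro card_mono) auto
        also have "\<dots> \<le> card {u\<in>U. \<forall>k\<in>?K. adj k u} + card (non_nbrs U v) + card (non_nbrs U x)
            + card (non_nbrs U y)"
          by (meson add_le_mono1 card_Un_le le_trans)
        finally have "card U \<le> card {u\<in>U. \<forall>k\<in>?K. adj k u} + 522 * err 3"
          using non [of v U] non [of x U] non [of y U] same v K U by simp
        moreover have "116 * err 2 * card (P - {f v}) \<le> 116 * (err 2 * real r)"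
          using err_pos [of 2] card_R by simp
        ultimately show ?thesis
          using P_size [of U] U e3 err_small err_chain err_pos [of 3] a_le_err by simp
      qed
      then obtain L where "L \<subseteq> V" "pairwise adj L" "card L = card ?K + 2 * card (P - {f v})"
        using extend_clique [OF P, of "P - {f v}" ?K] K finP by blast
      then show False
        using no_clique [of L] card_R card_K r_pos by simp
    qed
  qed
  have deg: "real (card (nbrs V v)) \<le> a + card V - card (W (f v))" if v: "v \<in> V" for v
  proof -
    have "nbrs V v \<subseteq> nbrs (W (f v)) v \<union> (V - W (f v))"
      by (auto simp: nbrs_def)
    then have "card (nbrs V v) \<le> card (nbrs (W (f v)) v \<union> (V - W (f v)))"
      using finite_V finW by (intro card_mono) auto
    also have "\<dots> \<le> card (nbrs (W (f v)) v) + card (V - W (f v))"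
      by (rule card_Un_le)
    finally have "card (nbrs V v) \<le> card (nbrs (W (f v)) v) + card (V - W (f v))" .
    moreover have "real (card (V - W (f v))) = real (card V) - card (W (f v))"
      using WV finite_V finW by (simp add: card_Diff_subset of_nat_diff card_mono)
    ultimately show ?thesis
      using inner [OF v] by linarith
  qed
  have "real (degree_sum V) \<le> (\<Sum>v\<in>V. a + card V - card (W (f v)))"
    unfolding degree_sum_def of_nat_sum by (intro sum_mono deg)
  also have "\<dots> = (a + card V) * card V - (\<Sum>v\<in>V. real (card (W (f v))))"
    by (simp add: sum_subtractf mult.commute)
  also have "(\<Sum>v\<in>V. real (card (W (f v)))) = (\<Sum>U\<in>P. \<Sum>v\<in>{v\<in>V. f v = U}. real (card (W (f v))))"
    using finP finite_V f by (intro sum.group [symmetric]) auto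
  also have "\<dots> = (\<Sum>U\<in>P. (real (card (W U)))\<^sup>2)"
    by (intro sum.cong) (auto simp: W_def power2_eq_square)
  finally have 1: "real (degree_sum V) \<le> (a + card V) * card V - (\<Sum>U\<in>P. (real (card (W U)))\<^sup>2)" .
  have "card V = (\<Sum>v\<in>V. 1)" by simp
  also have "\<dots> = (\<Sum>U\<in>P. \<Sum>v\<in>{v\<in>V. f v = U}. 1)"
    using finP finite_V f by (intro sum.group [symmetric]) auto
  also have "\<dots> = (\<Sum>U\<in>P. card (W U))"
    by (simp add: W_def)
  finally have sum_W: "(\<Sum>U\<in>P. real (card (W U))) = real (card V)"
    by (simp flip: of_nat_sum)
  \<comment> \<open>The average class size is \<open>part_size\<close>, so a nonnegative variance
    says that the sum of squares is least for equal classes.\<close>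
  have "0 \<le> (\<Sum>U\<in>P. (real (card (W U)) - part_size)\<^sup>2)"
    by (intro sum_nonneg) auto
  also have "\<dots> = (\<Sum>U\<in>P. (real (card (W U)))\<^sup>2) - 2 * part_size * (\<Sum>U\<in>P. real (card (W U)))
      + card P * part_size\<^sup>2"
    by (simp add: power2_diff sum.distrib sum_subtractf sum_distrib_left mult_ac)
  finally have "(real (card V))\<^sup>2 / r \<le> (\<Sum>U\<in>P. (real (card (W U)))\<^sup>2)"
    using r_pos by (simp add: sum_W card_P part_size_def power2_eq_square)
  then show ?thesis
    using 1 by (simp add: algebra_simps power2_eq_square)
qed

end

text \<open>Maximising the potential gives a subgraph of large minimum degree. Its complement is
  charged at rate \<open>c - \<kappa> / 2\<close> instead of \<open>c\<close>. If the subgraph has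
  fewer than half of the vertices, this gain outweighs the error of the weak bound; otherwise the
  dense bound applies to it.\<close>

lemma (in clique_free_graph) degree_sum_bound:
  assumes a: "8000 * real r ^ 4 * a \<le> card V"
  shows "real (degree_sum V) \<le> (1 - 1 / r) * (real (card V))\<^sup>2 + a * card V"
proof -
  \<comment> \<open>The largest value permitted by \<open>\<kappa>_small\<close>. The hypothesis
    becomes \<open>8 * a \<le> \<kappa> * n\<close>, where the factor 8 leaves enough even on half
    of the vertices.\<close>
  define \<kappa> where "\<kappa> = 1 / (1000 * real r ^ 4)"
  define c where "c = 1 - 1 / real r"
  define n where "n = real (card V)"
  have \<kappa>: "\<kappa> > 0" and a_\<kappa>: "8 * a \<le> \<kappa> * n"
    using r_pos a by (auto simp: \<kappa>_def n_def field_simps)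
  have c: "0 \<le> c" "c \<le> 1"
    using r_pos by (auto simp: c_def field_simps)
  define h where "h m = (c - \<kappa> / 2) * (real m)\<^sup>2" for m :: nat
  obtain S where S: "S \<subseteq> V"
    and max: "real (degree_sum V) - h (card V) \<le> real (degree_sum S) - h (card S)"
    and deg: "\<And>v. v \<in> S \<Longrightarrow> 2 * real (card (nbrs S v)) \<ge> h (card S) - h (card S - 1)"
    using exists_potential_maximizer [OF finite_V, of h] by metis
  interpret S: clique_free_graph adj S r a
    by (rule clique_free_subgraph [OF S])
  define m where "m = real (card S)"
  have mn: "0 \<le> m" "m \<le> n"
    using S finite_V by (auto simp: m_def n_def card_mono)
  have max': "real (degree_sum V) \<le> real (degree_sum S) + (c - \<kappa> / 2) * (n\<^sup>2 - m\<^sup>2)"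
    using max by (simp add: h_def n_def m_def algebra_simps)
  have sq: "m\<^sup>2 \<le> n\<^sup>2"
    using mn by (intro power_mono) auto
  have am: "a * m \<le> a * n"
    using mn a_pos by (intro mult_left_mono) auto
  consider "n = 0" | "n > 0" "2 * m < n" | "n > 0" "n \<le> 2 * m"
    using mn by linarith
  then show ?thesis
  proof cases
    case 1
    then show ?thesis
      using finite_V by (simp add: n_def degree_sum_def)
  next
    case 2
    \<comment> \<open>The error \<open>4 * a * m\<close> is at most \<open>2 * a * n\<close>, while
      the gain from the vertices outside \<open>S\<close> is at least
      \<open>3 / 8 * \<kappa> * n * n\<close>, hence at least \<open>3 * a * n\<close>.\<close>
    have "real (degree_sum S) \<le> c * m\<^sup>2 + 4 * (a * m)"
      using S.degree_sum_weak_bound by (simp add: c_def m_def)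
    moreover have "4 * m\<^sup>2 \<le> n\<^sup>2"
      using power_mono [of "2 * m" n 2] 2 mn by (simp add: power_mult_distrib)
    then have "\<kappa> * (4 * m\<^sup>2) \<le> \<kappa> * n\<^sup>2"
      using \<kappa> by (intro mult_left_mono) auto
    moreover have "(8 * a) * n \<le> (\<kappa> * n) * n"
      using a_\<kappa> mn by (intro mult_right_mono) auto
    moreover have "a * (2 * m) \<le> a * n" and "0 \<le> a * n"
      using 2 a_pos by (auto intro!: mult_left_mono)
    ultimately have "real (degree_sum V) \<le> c * n\<^sup>2 + a * n"
      using max' by (simp add: algebra_simps power2_eq_square)
    then show ?thesis
      by (simp add: c_def n_def)
  next
    case 3
    have "S \<noteq> {}"
      using 3 by (auto simp: m_def)
    then have a1: "a > 1" by (rule S.a_gt_1)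
    have m1: "card S \<ge> 1"
      using 3 by (simp add: m_def)
    have "\<kappa> * n \<le> \<kappa> * (2 * m)"
      using 3 \<kappa> by (intro mult_left_mono) auto
    then have a_m: "4 * a \<le> \<kappa> * m"
      using a_\<kappa> by simp
    interpret S: dense_clique_free_graph adj S r a \<kappa>
    proof
      show "(1 - 1 / real r - \<kappa>) * real (card S) \<le> real (card (nbrs S v))" if "v \<in> S" for v
      proof -
        have "h (card S) - h (card S - 1) = (c - \<kappa> / 2) * (2 * m - 1)"
          using m1 by (simp add: h_def m_def of_nat_diff power2_eq_square algebra_simps)
        then have "2 * real (card (nbrs S v)) \<ge> (c - \<kappa> / 2) * (2 * m - 1)"
          using deg [OF that] by simp
        then have "(c - \<kappa>) * m \<le> real (card (nbrs S v))"
          using a_m a1 c \<kappa> by (simp add: algebra_simps)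
        then show ?thesis
          by (simp add: c_def m_def)
      qed
    qed (use \<open>S \<noteq> {}\<close> \<kappa> a_m S.a_pos r_pos in \<open>auto simp: \<kappa>_def m_def\<close>)
    have "real (degree_sum S) \<le> c * m\<^sup>2 + a * m"
      using S.dense_degree_sum_bound by (simp add: c_def m_def)
    moreover have "0 \<le> \<kappa> * (n\<^sup>2 - m\<^sup>2)"
      using \<kappa> sq by simp
    ultimately have "real (degree_sum V) \<le> c * n\<^sup>2 + a * n"
      using max' am by (simp add: algebra_simps)
    then show ?thesis
      by (simp add: c_def n_def)
  qed
qed

section \<open>Arcs of a cycle\<close>

text \<open>Directed distance: the number of steps forward from \<open>k\<close> to
  \<open>l\<close>. Thus \<open>cyc_dist N i k < q\<close> describes the arc of \<open>q\<close>
  points starting at \<open>i\<close>.\<close>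

definition cyc_dist :: "nat \<Rightarrow> nat \<Rightarrow> nat \<Rightarrow> nat" where
  "cyc_dist N k l = (if k \<le> l then l - k else N + l - k)"

text \<open>Distance at least \<open>q\<close> both ways round; for \<open>2 * q \<le> N\<close>
  this is adjacency in the circular complete graph with parameter \<open>N / q\<close>.\<close>

definition far :: "nat \<Rightarrow> nat \<Rightarrow> nat \<Rightarrow> nat \<Rightarrow> bool" where
  "far N q k l \<longleftrightarrow> q \<le> cyc_dist N k l \<and> cyc_dist N k l + q \<le> N"

lemma far_sym: "q \<ge> 1 \<Longrightarrow> far N q k l \<Longrightarrow> far N q l k"
  by (auto simp: far_def cyc_dist_def split: if_splits)

lemma not_far_same: "q \<ge> 1 \<Longrightarrow> \<not> far N q k k"
  by (simp add: far_def cyc_dist_def)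

lemma not_far_common_start:
  assumes "k < N" "l < N" "i < N" "cyc_dist N i k < q" "cyc_dist N i l < q"
  shows "\<not> far N q k l"
  using assms by (auto simp: far_def cyc_dist_def split: if_splits)

lemma not_far_common_end:
  assumes "k < N" "i < N" "j < N" "cyc_dist N i k < q" "cyc_dist N j k < q"
  shows "\<not> far N q i j"
  using assms by (auto simp: far_def cyc_dist_def split: if_splits)

lemma far_triangle_free:
  assumes "i < N" "j < N" "k < N" "N < 3 * q"
  shows "\<not> (far N q i j \<and> far N q j k \<and> far N q i k)"
  using assms by (auto simp: far_def cyc_dist_def split: if_splits)

lemma cyc_dist_less: "k < N \<Longrightarrow> l < N \<Longrightarrow> cyc_dist N k l < N"
  by (auto simp: cyc_dist_def)

lemma bij_betw_cyc_dist:
  assumes "k < N"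
  shows "bij_betw (cyc_dist N k) {..<N} {..<N}" "bij_betw (\<lambda>i. cyc_dist N i k) {..<N} {..<N}"
proof -
  have inj: "inj_on (cyc_dist N k) {..<N}" "inj_on (\<lambda>i. cyc_dist N i k) {..<N}"
    using assms by (auto simp: inj_on_def cyc_dist_def split: if_splits)
  have sub: "cyc_dist N k ` {..<N} \<subseteq> {..<N}" "(\<lambda>i. cyc_dist N i k) ` {..<N} \<subseteq> {..<N}"
    using assms cyc_dist_less by auto
  show "bij_betw (cyc_dist N k) {..<N} {..<N}" "bij_betw (\<lambda>i. cyc_dist N i k) {..<N} {..<N}"
    using inj sub endo_inj_surj [of "{..<N}"] by (auto simp: bij_betw_def)
qed

lemma card_filter_bij_betw:
  assumes "bij_betw f A B"
  shows "card {a\<in>A. P (f a)} = card {b\<in>B. P b}"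
  using assms by (intro bij_betw_same_card [of f]) (auto simp: bij_betw_def inj_on_def)

lemma card_cyc_arc:
  assumes "k < N" "q \<le> N"
  shows "card {l\<in>{..<N}. cyc_dist N k l < q} = q" "card {i\<in>{..<N}. cyc_dist N i k < q} = q"
proof -
  have "{d\<in>{..<N}. d < q} = {..<q}"
    using assms by auto
  then show "card {l\<in>{..<N}. cyc_dist N k l < q} = q" "card {i\<in>{..<N}. cyc_dist N i k < q} = q"
    using card_filter_bij_betw [OF bij_betw_cyc_dist(1) [OF assms(1)], of "\<lambda>d. d < q"]
      card_filter_bij_betw [OF bij_betw_cyc_dist(2) [OF assms(1)], of "\<lambda>d. d < q"] by simp_all
qed

lemma card_far:
  assumes "k < N" "q \<ge> 1"
  shows "card {l\<in>{..<N}. far N q k l} = N + 1 - 2 * q"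
proof -
  have "{d\<in>{..<N}. q \<le> d \<and> d + q \<le> N} = {q..<N + 1 - q}"
    using assms by auto
  then show ?thesis
    using card_filter_bij_betw [OF bij_betw_cyc_dist(1) [OF assms(1)], of "\<lambda>d. q \<le> d \<and> d + q \<le> N"]
    by (simp add: far_def)
qed

lemma cyclically_closed_eq:
  assumes U: "U \<subseteq> {..<N}" "k \<in> U"
    and closed: "\<And>k. k \<in> U \<Longrightarrow> (if Suc k = N then 0 else Suc k) \<in> U"
  shows "U = {..<N}"
proof -
  have up: "k + j < N \<Longrightarrow> k + j \<in> U" if "k \<in> U" for j k
    using that by (induction j) (use closed in force)+
  have "k < N"
    using U by auto
  then have "k + (N - 1 - k) \<in> U"
    using U by (intro up) auto
  then have "N - 1 \<in> U"
    using \<open>k < N\<close> by simp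
  then have "0 \<in> U"
    using closed [of "N - 1"] \<open>k < N\<close> by auto
  then show ?thesis
    using up [of 0] U by auto
qed

text \<open>A sumset estimate on the cycle: a nonempty set plus an interval. Lengthening the arcs by
  one adds a point unless the union is closed under successors and therefore everything. The
  \<open>Suc\<close> on both sides avoids a truncated subtraction.\<close>

lemma card_union_arcs:
  assumes T: "T \<subseteq> {..<N}" "T \<noteq> {}" and "m \<ge> 1" "s + m \<le> N"
  shows "min (Suc N) (card T + m) \<le> Suc (card {l\<in>{..<N}. \<exists>k\<in>T. s \<le> cyc_dist N k l \<and> cyc_dist N k l < s + m})"
  using assms(3,4)
proof (induction m rule: dec_induct)
  case base
  define g where "g k = (if k + s < N then k + s else k + s - N)" for k
  have "s < N"
    using base by simp
  have "inj_on g T"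
    using T(1) \<open>s < N\<close> by (auto simp: inj_on_def g_def split: if_splits)
  then have "card T = card (g ` T)"
    by (simp add: card_image)
  also have "\<dots> \<le> card {l\<in>{..<N}. \<exists>k\<in>T. s \<le> cyc_dist N k l \<and> cyc_dist N k l < s + 1}"
  proof (intro card_mono subsetI)
    fix l assume "l \<in> g ` T"
    then obtain k where k: "k \<in> T" "l = g k" by auto
    then have "k < N" using T by auto
    then have "l < N" "cyc_dist N k l = s"
      using \<open>s < N\<close> k by (auto simp: g_def cyc_dist_def)
    then show "l \<in> {l\<in>{..<N}. \<exists>k\<in>T. s \<le> cyc_dist N k l \<and> cyc_dist N k l < s + 1}"
      using k by auto
  qed auto
  finally show ?case by simp
next
  case (step m)
  let ?U = "\<lambda>m. {l\<in>{..<N}. \<exists>k\<in>T. s \<le> cyc_dist N k l \<and> cyc_dist N k l < s + m}"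
  have IH: "min (Suc N) (card T + m) \<le> Suc (card (?U m))"
    using step by simp
  have mono: "?U m \<subseteq> ?U (Suc m)" by force
  show ?case
  proof (cases "?U m = {..<N}")
    case True
    then have "?U (Suc m) = {..<N}"
      using mono by blast
    then have "card (?U (Suc m)) = N" by simp
    then show ?thesis by simp
  next
    case False
    have ne: "?U m \<noteq> {}"
    proof
      assume "?U m = {}"
      then have "card (?U m) = 0" by (simp only: card.empty)
      moreover have "card T \<ge> 1"
        using T finite_subset [OF T(1)] by (simp add: Suc_le_eq card_gt_0_iff)
      ultimately show False
        using IH step by linarith
    qed
    obtain k where k: "k \<in> ?U m" "(if Suc k = N then 0 else Suc k) \<notin> ?U m"
    proof (rule ccontr)
      assume *: "\<not> thesis"
      obtain k where "k \<in> ?U m" using ne by blast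
      then have "?U m = {..<N}"
        using * that by (intro cyclically_closed_eq [of _ N k]) blast+
      then show False using False by blast
    qed
    define k' where "k' = (if Suc k = N then 0 else Suc k)"
    obtain t where t: "t \<in> T" "s \<le> cyc_dist N t k" "cyc_dist N t k < s + m"
      using k by auto
    have "t < N" "k < N"
      using t T k by auto
    then have "k' < N" "cyc_dist N t k' = Suc (cyc_dist N t k)"
      using t step.prems unfolding k'_def cyc_dist_def by (auto split: if_splits)
    then have "insert k' (?U m) \<subseteq> ?U (Suc m)"
      using t mono by force
    then have "card (insert k' (?U m)) \<le> card (?U (Suc m))"
      by (intro card_mono) auto
    moreover have "card (insert k' (?U m)) = Suc (card (?U m))"
      using k(2) unfolding k'_def by (intro card_insert_disjoint) auto
    ultimately show ?thesis
      using IH by linarith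
  qed
qed

text \<open>The points far from some element of \<open>T\<close> form a union of arcs of length
  \<open>N + 1 - 2 * q\<close>. By \<open>card_union_arcs\<close> there are at least
  \<open>card T + N - 2 * q\<close> of them, and \<open>T'\<close> avoids them all.\<close>

lemma card_cross_close:
  assumes N: "q \<ge> 1" "2 * q \<le> N \<or> N = 1 \<and> q = 1"
    and T: "T \<subseteq> {..<N}" "T \<noteq> {}" and T': "T' \<subseteq> {..<N}" "T' \<noteq> {}"
    and close: "\<And>k l. k \<in> T \<Longrightarrow> l \<in> T' \<Longrightarrow> \<not> far N q k l"
  shows "card T + card T' \<le> 2 * q"
proof (cases "2 * q \<le> N")
  case False
  then have "card T \<le> q" "card T' \<le> q"
    using N T T' card_mono [of "{..<N}"] by force+
  then show ?thesis by simp
next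
  case True
  let ?U = "{l\<in>{..<N}. \<exists>k\<in>T. q \<le> cyc_dist N k l \<and> cyc_dist N k l < q + (N + 1 - 2 * q)}"
  have disj: "?U \<inter> T' = {}"
    using close True N by (force simp: far_def)
  have "card ?U + card T' = card (?U \<union> T')"
    using disj T' by (intro card_Un_disjoint [symmetric]) (auto intro: finite_subset)
  also have "\<dots> \<le> N"
    using T' card_mono [of "{..<N}" "?U \<union> T'"] by auto
  finally have "card ?U + card T' \<le> N" .
  moreover have "card T' \<ge> 1"
    using T' finite_subset [OF T'(1)] by (simp add: Suc_le_eq card_gt_0_iff)
  moreover have "min (Suc N) (card T + (N + 1 - 2 * q)) \<le> Suc (card ?U)"
    using True N T by (intro card_union_arcs) auto
  ultimately show ?thesis
    using True N by linarith
qed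

section \<open>Tight weightings of triangle-free graphs\<close>

lemma sum_if_const:
  fixes t :: real
  assumes "finite A"
  shows "(\<Sum>k\<in>A. if P k then t else 0) = card {k\<in>A. P k} * t"
  using assms by (simp flip: sum.inter_filter)

text \<open>Neighbourhoods are stable by triangle-freeness, so \<open>degree_one\<close> makes each
  of them a heaviest stable set. In a blow-up the degrees then match the bound on stable sets up to
  rounding.\<close>

locale tight_graph = simple_graph adj for adj :: "'a \<Rightarrow> 'a \<Rightarrow> bool" +
  fixes V :: "'a set" and w :: "'a \<Rightarrow> real"
  assumes finite_V: "finite V"
    and triangle_free: "u \<in> V \<Longrightarrow> v \<in> V \<Longrightarrow> t \<in> V \<Longrightarrow> adj u v \<Longrightarrow> adj v t \<Longrightarrow> \<not> adj u t"
    and w_nonneg: "v \<in> V \<Longrightarrow> w v \<ge> 0"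
    and degree_one: "v \<in> V \<Longrightarrow> sum w (nbrs V v) = 1"
    and stable_le_one: "A \<subseteq> V \<Longrightarrow> stable adj A \<Longrightarrow> sum w A \<le> 1"
begin

definition total :: real where "total = sum w V"

text \<open>The neighbourhood of a vertex chosen at random according to \<open>w\<close> is a stable set covering
  every vertex with the same probability; adding its trace on \<open>B\<close> to \<open>A\<close> keeps \<open>A\<close> stable.\<close>

lemma stable_anticomplete:
  assumes A: "A \<subseteq> V" "stable adj A" and B: "B \<subseteq> V" "A \<inter> B = {}"
    and no_edges: "\<And>u v. u \<in> A \<Longrightarrow> v \<in> B \<Longrightarrow> \<not> adj u v"
  shows "total * sum w A + sum w B \<le> total"
proof -
  have fin: "finite A" "finite B"
    using A B finite_V by (auto intro: finite_subset)
  have le1: "sum w A + sum w (nbrs B v) \<le> 1" if v: "v \<in> V" for v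
  proof -
    have "stable adj (A \<union> nbrs B v)"
      using A no_edges triangle_free [OF v] B adj_sym unfolding stable_def nbrs_def by blast
    then have "sum w (A \<union> nbrs B v) \<le> 1"
      using A B nbrs_subset by (intro stable_le_one) blast+
    moreover have "A \<inter> nbrs B v = {}"
      using B nbrs_subset by blast
    ultimately show ?thesis
      using fin by (simp add: sum.union_disjoint)
  qed
  have "(\<Sum>v\<in>V. w v * sum w (nbrs B v)) = (\<Sum>v\<in>V. \<Sum>u\<in>B. if adj v u then w v * w u else 0)"
    using fin by (simp add: nbrs_def sum_distrib_left sum.inter_filter if_distrib cong: if_cong)
  also have "\<dots> = (\<Sum>u\<in>B. \<Sum>v\<in>V. if adj u v then w u * w v else 0)"
    by (subst sum.swap) (auto intro!: sum.cong dest: adj_sym)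
  also have "\<dots> = (\<Sum>u\<in>B. w u * sum w (nbrs V u))"
    using finite_V by (simp add: nbrs_def sum_distrib_left sum.inter_filter if_distrib cong: if_cong)
  also have "\<dots> = sum w B"
    using B degree_one by (intro sum.cong) auto
  finally have "total * sum w A + sum w B = (\<Sum>v\<in>V. w v * (sum w A + sum w (nbrs B v)))"
    by (simp add: total_def algebra_simps sum.distrib flip: sum_distrib_left sum_distrib_right)
  also have "\<dots> \<le> (\<Sum>v\<in>V. w v * 1)"
    using le1 w_nonneg by (intro sum_mono mult_left_mono) auto
  finally show ?thesis
    by (simp add: total_def)
qed

text \<open>The level sets \<open>{f \<ge> s}\<close> and \<open>{f \<ge> 2q + 1 - s}\<close> are anticomplete to each other, so
  the previous lemma bounds the sum of their weights.\<close>

lemma weighted_level_bound: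
  fixes f :: "'a \<Rightarrow> nat"
  assumes total: "total \<ge> 2" and f_le: "\<And>u. u \<in> V \<Longrightarrow> f u \<le> m"
    and f_adj: "\<And>u v. u \<in> V \<Longrightarrow> v \<in> V \<Longrightarrow> adj u v \<Longrightarrow> f u = 0 \<or> f v = 0 \<or> f u + f v \<le> 2 * q"
    and A: "A \<subseteq> V" "stable adj A" and A_adj: "\<And>u v. u \<in> A \<Longrightarrow> v \<in> V \<Longrightarrow> adj u v \<Longrightarrow> f v = 0"
  obtains h where "sum w A \<le> h" "0 \<le> h" "h \<le> 1"
    "(\<Sum>u\<in>V. f u * w u) \<le> h * m + (1 - h) * (q * total)"
proof -
  \<comment> \<open>Like the vertices of \<open>A\<close>, those with \<open>f u > 2 * q\<close>
    have only neighbours where \<open>f\<close> vanishes. On \<open>H\<close> only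
    \<open>f u \<le> m\<close> is used; outside it \<open>f\<close> is at most
    \<open>2 * q\<close>.\<close>
  define H where "H = A \<union> {u\<in>V. 2 * q < f u}"
  define h where "h = sum w H"
  have HV: "H \<subseteq> V" and finH: "finite H"
    using A finite_V by (auto simp: H_def intro: finite_subset)
  have H_adj: "f v = 0" if "u \<in> H" "v \<in> V" "adj u v" for u v
    using that A_adj f_adj [of u v] by (force simp: H_def)
  have H_stable: "stable adj H"
    unfolding stable_def
  proof (intro ballI notI)
    fix u v assume uv: "u \<in> H" "v \<in> H" "adj u v"
    then have "f u = 0" "f v = 0"
      using H_adj HV adj_sym by blast+
    then have "u \<in> A" "v \<in> A"
      using uv by (auto simp: H_def)
    then show False
      using A(2) uv by (auto simp: stable_def)
  qed
  have "sum w A \<le> h"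
    unfolding h_def using finH HV w_nonneg by (intro sum_mono2) (auto simp: H_def)
  have "0 \<le> h"
    unfolding h_def using HV w_nonneg by (intro sum_nonneg) auto
  have "h \<le> 1"
    unfolding h_def using HV H_stable by (rule stable_le_one)
  have "(\<Sum>u\<in>H. f u * w u) \<le> (\<Sum>u\<in>H. real m * w u)"
    using HV f_le w_nonneg by (intro sum_mono mult_right_mono) auto
  then have on_H: "(\<Sum>u\<in>H. f u * w u) \<le> h * m"
    by (simp add: h_def mult.commute flip: sum_distrib_left)
  define B where "B s = {u\<in>V - H. s \<le> f u}" for s
  have level: "sum w (B s) + sum w (B (2 * q + 1 - s)) \<le> (1 - h) * total" if s: "s \<in> {1..q}" for s
  proof -
    define C where "C = B (2 * q + 1 - s)"
    have CB: "C \<subseteq> B s" and BV: "B s \<subseteq> V" and fin: "finite (B s)" "finite C"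
      and disj: "H \<inter> C = {}"
      using s finite_V by (auto simp: C_def B_def)
    have C_adj: "\<not> adj u v" if "u \<in> C" "v \<in> B s" for u v
      using that f_adj [of u v] s by (auto simp: C_def B_def)
    have HB_adj: "\<not> adj u v" if "u \<in> H" "v \<in> B s" for u v
      using that H_adj [of u v] s by (auto simp: B_def)
    have "stable adj (H \<union> C)"
      using H_stable C_adj HB_adj CB adj_sym unfolding stable_def by blast
    then have "total * sum w (H \<union> C) + sum w (B s - C) \<le> total"
      using HV CB BV C_adj HB_adj
      by (intro stable_anticomplete) (auto simp: B_def)
    moreover have "sum w (H \<union> C) = h + sum w C"
      using disj finH fin by (simp add: sum.union_disjoint h_def)
    moreover have "sum w (B s - C) = sum w (B s) - sum w C"
      using fin CB by (simp add: sum_diff)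
    \<comment> \<open>In the preceding inequality \<open>C\<close> is counted with factor
      \<open>total - 1\<close>, and \<open>total \<ge> 2\<close> allows this to be lowered to
      one.\<close>
    moreover have "0 \<le> (total - 2) * sum w C"
      using total w_nonneg CB BV by (intro mult_nonneg_nonneg sum_nonneg) auto
    ultimately show ?thesis
      unfolding C_def by (simp add: algebra_simps)
  qed
  \<comment> \<open>The values \<open>1..2q\<close> are split into the pairs \<open>s\<close> and
    \<open>2 * q + 1 - s\<close>, to which \<open>level\<close> applies.\<close>
  have count: "real (f u) = (\<Sum>s=1..q. (if s \<le> f u then 1 else 0) + (if 2 * q + 1 - s \<le> f u then 1 else 0))"
    if "u \<in> V - H" for u
  proof -
    have "f u \<le> 2 * q"
      using that by (auto simp: H_def)
    moreover have "{s\<in>{1..q}. s \<le> f u} = {1..min q (f u)}"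
      "{s\<in>{1..q}. 2 * q + 1 - s \<le> f u} = {2 * q + 1 - f u..q}"
      using \<open>f u \<le> 2 * q\<close> by auto
    ultimately show ?thesis
      by (simp add: sum.distrib sum_if_const)
  qed
  have "(\<Sum>u\<in>V - H. f u * w u)
      = (\<Sum>u\<in>V - H. \<Sum>s=1..q. (if s \<le> f u then w u else 0) + (if 2 * q + 1 - s \<le> f u then w u else 0))"
    by (intro sum.cong refl, subst count) (auto simp: sum_distrib_right intro!: sum.cong)
  also have "\<dots> = (\<Sum>s=1..q. \<Sum>u\<in>V - H. (if s \<le> f u then w u else 0) + (if 2 * q + 1 - s \<le> f u then w u else 0))"
    by (rule sum.swap)
  also have "\<dots> = (\<Sum>s=1..q. sum w (B s) + sum w (B (2 * q + 1 - s)))"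
    using finite_V by (simp add: sum.distrib B_def flip: sum.inter_filter)
  also have "\<dots> \<le> (\<Sum>s=1..q. (1 - h) * total)"
    by (intro sum_mono level)
  finally have "(\<Sum>u\<in>V - H. f u * w u) \<le> (1 - h) * (q * total)"
    by (simp add: mult_ac)
  moreover have "(\<Sum>u\<in>V. f u * w u) = (\<Sum>u\<in>V - H. f u * w u) + (\<Sum>u\<in>H. f u * w u)"
    using HV finite_V by (simp add: sum.subset_diff)
  ultimately show ?thesis
    using that [of h] \<open>sum w A \<le> h\<close> \<open>0 \<le> h\<close> \<open>h \<le> 1\<close> on_H by simp
qed

end

section \<open>The cyclic extension\<close>

datatype 'a ext_vertex = Base 'a | Layer 'a nat | Apex nat

text \<open>The layers carry the product of \<open>adj\<close> with the circular graph
  \<open>far\<close>, and the apices carry \<open>far\<close> itself. For \<open>N = q = 1\<close>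
  the relation \<open>far\<close> is empty and the construction is Mycielski's.\<close>

fun ext_adj :: "('a \<Rightarrow> 'a \<Rightarrow> bool) \<Rightarrow> nat \<Rightarrow> nat \<Rightarrow> 'a ext_vertex \<Rightarrow> 'a ext_vertex \<Rightarrow> bool" where
  "ext_adj adj N q (Base u) (Base v) = adj u v"
| "ext_adj adj N q (Base u) (Layer v k) = adj u v"
| "ext_adj adj N q (Base u) (Apex i) = False"
| "ext_adj adj N q (Layer u k) (Base v) = adj u v"
| "ext_adj adj N q (Layer u k) (Layer v l) = (adj u v \<and> far N q k l)"
| "ext_adj adj N q (Layer u k) (Apex i) = (cyc_dist N i k < q)"
| "ext_adj adj N q (Apex i) (Base v) = False"
| "ext_adj adj N q (Apex i) (Layer v k) = (cyc_dist N i k < q)"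
| "ext_adj adj N q (Apex i) (Apex j) = far N q i j"

fun ext_weight :: "('a \<Rightarrow> real) \<Rightarrow> real \<Rightarrow> real \<Rightarrow> real \<Rightarrow> 'a ext_vertex \<Rightarrow> real" where
  "ext_weight w a b c (Base v) = a * w v"
| "ext_weight w a b c (Layer v k) = b * w v"
| "ext_weight w a b c (Apex i) = c"

definition ext_vertices :: "'a set \<Rightarrow> nat \<Rightarrow> 'a ext_vertex set" where
  "ext_vertices V N = Base ` V \<union> case_prod Layer ` (V \<times> {..<N}) \<union> Apex ` {..<N}"

lemma in_ext_vertices [simp]:
  "Base v \<in> ext_vertices V N \<longleftrightarrow> v \<in> V"
  "Layer v k \<in> ext_vertices V N \<longleftrightarrow> v \<in> V \<and> k < N"
  "Apex i \<in> ext_vertices V N \<longleftrightarrow> i < N"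
  by (auto simp: ext_vertices_def)

lemma finite_ext_vertices: "finite V \<Longrightarrow> finite (ext_vertices V N)"
  by (simp add: ext_vertices_def)

lemma sum_ext_vertices:
  assumes "finite V"
  shows "sum g (ext_vertices V N)
    = (\<Sum>v\<in>V. g (Base v)) + (\<Sum>v\<in>V. \<Sum>k<N. g (Layer v k)) + (\<Sum>i<N. g (Apex i))"
proof -
  have "sum g (ext_vertices V N) = sum g (Base ` V \<union> case_prod Layer ` (V \<times> {..<N})) + sum g (Apex ` {..<N})"
    unfolding ext_vertices_def using assms by (intro sum.union_disjoint) auto
  also have "sum g (Base ` V \<union> case_prod Layer ` (V \<times> {..<N})) = sum g (Base ` V) + sum g (case_prod Layer ` (V \<times> {..<N}))"
    using assms by (intro sum.union_disjoint) auto
  also have "sum g (case_prod Layer ` (V \<times> {..<N})) = (\<Sum>v\<in>V. \<Sum>k<N. g (Layer v k))"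
    by (subst sum.reindex) (auto simp: inj_on_def sum.cartesian_product intro!: sum.cong)
  finally show ?thesis
    by (simp add: sum.reindex inj_on_def)
qed

lemma sum_ext_weight_filter:
  fixes w :: "'a \<Rightarrow> real" and a b c :: real
  assumes "finite V"
  shows "sum (ext_weight w a b c) {x\<in>ext_vertices V N. P x}
    = (\<Sum>v\<in>V. if P (Base v) then a * w v else 0)
      + (\<Sum>v\<in>V. card {k\<in>{..<N}. P (Layer v k)} * (b * w v)) + card {i\<in>{..<N}. P (Apex i)} * c"
  using assms
  by (simp add: sum.inter_filter finite_ext_vertices sum_ext_vertices sum_if_const cong: if_cong)

locale cyclic_extension = tight_graph +
  fixes N q :: nat
  assumes q_pos: "q \<ge> 1" and N_less: "N < 3 * q" and N_ge: "2 * q \<le> N \<or> N = 1 \<and> q = 1"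
    and total_ge: "total \<ge> 2"
begin

text \<open>The weights are forced by requiring all weighted degrees to be one.\<close>

definition layer_weight :: real where
  "layer_weight = 1 / (q * total + (N + 1 - 2 * q) * ((2 * q - 1) / q))"

definition apex_weight :: real where
  "apex_weight = (2 * q - 1) / q * layer_weight"

definition base_weight :: real where
  "base_weight = 1 - N * layer_weight"

lemma real_N: "real (N + 1 - 2 * q) = real N + 1 - 2 * real q"
  using N_ge by auto

lemma real_q: "real (2 * q - 1) = 2 * real q - 1"
  using q_pos by (simp add: of_nat_diff)

lemma layer_weight_pos: "layer_weight > 0"
proof -
  have "q * total > 0"
    using q_pos total_ge by simp
  moreover have "(N + 1 - 2 * q) * ((2 * q - 1) / q) \<ge> (0 :: real)"
    by simp
  ultimately show ?thesis
    unfolding layer_weight_def by (intro divide_pos_pos) linarith+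
qed

lemma apex_weight_bounds: "layer_weight \<le> apex_weight" "apex_weight \<le> 2 * layer_weight"
  unfolding apex_weight_def using layer_weight_pos q_pos
  by (auto simp: real_q field_simps)

lemma q_times_apex_weight: "q * apex_weight = (2 * real q - 1) * layer_weight"
  unfolding apex_weight_def real_q using q_pos by simp

lemma apex_degree: "q * (layer_weight * total) + (N + 1 - 2 * q) * apex_weight = 1"
proof -
  have "q * (layer_weight * total) + (N + 1 - 2 * q) * apex_weight
      = layer_weight * (q * total + (N + 1 - 2 * q) * ((2 * q - 1) / q))"
    by (simp add: apex_weight_def algebra_simps)
  also have "\<dots> = 1"
    using layer_weight_pos unfolding layer_weight_def by simp
  finally show ?thesis .
qed

lemma base_weight_nonneg: "base_weight \<ge> 0"
proof -
  have "layer_weight * (real q * 2) \<le> layer_weight * (q * total)"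
    using layer_weight_pos total_ge by (intro mult_left_mono) auto
  moreover have "(N + 1 - 2 * q) * layer_weight \<le> (N + 1 - 2 * q) * apex_weight"
    using apex_weight_bounds by (intro mult_left_mono) auto
  ultimately have "layer_weight * (real q * 2) + (N + 1 - 2 * q) * layer_weight \<le> 1"
    using apex_degree by (simp add: mult_ac)
  then have "layer_weight * (N + 1) \<le> 1"
    unfolding real_N by (simp add: algebra_simps)
  then show ?thesis
    using layer_weight_pos unfolding base_weight_def by (simp add: algebra_simps)
qed

abbreviation "W \<equiv> ext_vertices V N"
abbreviation "wt \<equiv> ext_weight w base_weight layer_weight apex_weight"
abbreviation "adj' \<equiv> ext_adj adj N q"

lemma ext_simple_graph: "simple_graph adj'"
proof
  show "adj' x y \<Longrightarrow> adj' y x" for x y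
    using far_sym [OF q_pos] adj_sym by (cases x; cases y) auto
  show "\<not> adj' x x" for x
    using adj_irrefl not_far_same [OF q_pos] by (cases x) auto
qed

interpretation ext: simple_graph adj'
  by (rule ext_simple_graph)

text \<open>A triangle without apices projects to one in \<open>V\<close>. Two layer vertices
  adjacent to one apex lie in a common arc, so their layers are not far; two apices adjacent to one
  layer vertex start arcs with a common point, so they are not far either. Three pairwise far apices
  would need \<open>N \<ge> 3 * q\<close>.\<close>

lemma ext_triangle_free:
  assumes "x \<in> W" "y \<in> W" "z \<in> W" "adj' x y" "adj' y z"
  shows "\<not> adj' x z"
proof
  assume "adj' x z"
  then show False
    using assms
    by (cases x; cases y; cases z; simp)
       (metis triangle_free | metis not_far_common_start | metis not_far_common_end
         | metis not_far_common_start far_sym [OF q_pos] | metis not_far_common_end far_sym [OF q_pos]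
         | metis far_triangle_free [OF _ _ _ N_less])+
qed

lemma ext_degree:
  assumes "x \<in> W"
  shows "sum wt (ext.nbrs W x) = 1"
proof -
  have q_le: "q \<le> N"
    using N_ge by auto
  have nbr_sum: "sum w {u\<in>V. adj v u} = 1" if "v \<in> V" for v
    using degree_one [OF that] by (simp add: nbrs_def)
  have filt: "(\<Sum>u\<in>V. if adj v u then t * w u else 0) = t" if "v \<in> V" for v t
    using nbr_sum [OF that] finite_V by (simp flip: sum.inter_filter sum_distrib_left)
  show ?thesis
  proof (cases x)
    case (Base v)
    then have v: "v \<in> V"
      using assms by simp
    have "sum wt (ext.nbrs W x) = (\<Sum>u\<in>V. if adj v u then base_weight * w u else 0)
        + (\<Sum>u\<in>V. card {k\<in>{..<N}. adj v u} * (layer_weight * w u))"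
      unfolding ext.nbrs_def Base
      using sum_ext_weight_filter [OF finite_V, of w base_weight layer_weight apex_weight N "adj' (Base v)"]
      by simp
    also have "(\<Sum>u\<in>V. card {k\<in>{..<N}. adj v u} * (layer_weight * w u))
        = (\<Sum>u\<in>V. if adj v u then N * layer_weight * w u else 0)"
      by (intro sum.cong) auto
    finally show ?thesis
      using v by (simp add: filt base_weight_def)
  next
    case (Layer v k)
    then have v: "v \<in> V" "k < N"
      using assms by simp_all
    have "sum wt (ext.nbrs W x) = (\<Sum>u\<in>V. if adj v u then base_weight * w u else 0)
        + (\<Sum>u\<in>V. card {l\<in>{..<N}. adj v u \<and> far N q k l} * (layer_weight * w u))
        + card {i\<in>{..<N}. cyc_dist N i k < q} * apex_weight"
      unfolding ext.nbrs_def Layer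
      using sum_ext_weight_filter [OF finite_V, of w base_weight layer_weight apex_weight N "adj' (Layer v k)"]
      by simp
    also have "card {i\<in>{..<N}. cyc_dist N i k < q} = q"
      using v q_le by (intro card_cyc_arc)
    also have "(\<Sum>u\<in>V. card {l\<in>{..<N}. adj v u \<and> far N q k l} * (layer_weight * w u))
        = (\<Sum>u\<in>V. if adj v u then (N + 1 - 2 * q) * layer_weight * w u else 0)"
      using card_far [OF v(2) q_pos] by (intro sum.cong) auto
    finally have "sum wt (ext.nbrs W x) = base_weight + (N + 1 - 2 * q) * layer_weight + q * apex_weight"
      using v by (simp only: filt)
    also have "\<dots> = 1"
      unfolding real_N q_times_apex_weight by (simp add: base_weight_def algebra_simps)
    finally show ?thesis .
  next
    case (Apex i)
    then have i: "i < N"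
      using assms by simp
    have "sum wt (ext.nbrs W x)
        = (\<Sum>u\<in>V. card {k\<in>{..<N}. cyc_dist N i k < q} * (layer_weight * w u))
        + card {j\<in>{..<N}. far N q i j} * apex_weight"
      unfolding ext.nbrs_def Apex
      using sum_ext_weight_filter [OF finite_V, of w base_weight layer_weight apex_weight N "adj' (Apex i)"]
      by simp
    also have "card {k\<in>{..<N}. cyc_dist N i k < q} = q"
      using i q_le by (intro card_cyc_arc)
    also have "card {j\<in>{..<N}. far N q i j} = N + 1 - 2 * q"
      using i q_pos by (intro card_far)
    also have "(\<Sum>u\<in>V. q * (layer_weight * w u)) = q * (layer_weight * total)"
      by (simp add: total_def sum_distrib_left)
    finally show ?thesis
      using apex_degree by simp
  qed
qed

text \<open>Once the apices in \<open>I\<close> are fixed, copies can only lie in the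
  \<open>m\<close> layers they leave uncovered. The level bound then estimates the weight of
  \<open>I\<close> by an affine function of \<open>h\<close> on the unit interval, so it suffices to
  check \<open>h = 1\<close> and \<open>h = 0\<close>.\<close>

lemma ext_stable_le_one:
  assumes I: "I \<subseteq> W" "stable adj' I"
  shows "sum wt I \<le> 1"
proof -
  define A where "A = {v\<in>V. Base v \<in> I}"
  define T where "T v = {k\<in>{..<N}. Layer v k \<in> I}" for v
  define Q where "Q = {i\<in>{..<N}. Apex i \<in> I}"
  define F where "F = {k\<in>{..<N}. \<forall>i\<in>Q. \<not> cyc_dist N i k < q}"
  define f where "f v = card (T v)" for v
  define m where "m = card F"
  have no_adj: "\<not> adj' x y" if "x \<in> I" "y \<in> I" for x y
    using I that by (auto simp: stable_def)
  have T_F: "T v \<subseteq> F" if "v \<in> V" for v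
    using no_adj by (force simp: T_def F_def Q_def)
  have T_sub: "T v \<subseteq> {..<N}" and finT: "finite (T v)" for v
    by (auto simp: T_def)
  have finF: "finite F"
    by (auto simp: F_def Q_def)
  have sum_I: "sum wt I = base_weight * sum w A + layer_weight * (\<Sum>v\<in>V. f v * w v) + card Q * apex_weight"
  proof -
    have "I = {x\<in>W. x \<in> I}"
      using I by auto
    then have "sum wt I = sum wt {x\<in>W. x \<in> I}" by simp
    also have "\<dots> = base_weight * sum w A + layer_weight * (\<Sum>v\<in>V. f v * w v) + card Q * apex_weight"
      using finite_V
      by (simp add: sum_ext_weight_filter A_def f_def T_def Q_def sum.inter_filter sum_distrib_left
            mult_ac if_distrib cong: if_cong)
    finally show ?thesis .
  qed
  have A: "A \<subseteq> V" "stable adj A"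
    using no_adj by (force simp: A_def stable_def)+
  have A_adj: "f v = 0" if "u \<in> A" "v \<in> V" "adj u v" for u v
    using no_adj [of "Base u" "Layer v k" for k] that by (auto simp: f_def T_def A_def)
  \<comment> \<open>The bound \<open>2 * q\<close> comes from \<open>card_cross_close\<close> and
    the bound \<open>2 * m\<close> from \<open>T_F\<close>; hence the level bound is used with
    \<open>min q m\<close>.\<close>
  have f_adj: "f u = 0 \<or> f v = 0 \<or> f u + f v \<le> 2 * p"
    if uv: "u \<in> V" "v \<in> V" "adj u v" and p: "p = min q m" for u v p
  proof -
    consider "T u = {}" | "T v = {}" | "T u \<noteq> {}" "T v \<noteq> {}" by blast
    then show ?thesis
    proof cases
      case 3
      have "\<not> far N q k l" if "k \<in> T u" "l \<in> T v" for k l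
        using no_adj [of "Layer u k" "Layer v l"] that uv by (auto simp: T_def)
      then have "f u + f v \<le> 2 * q"
        unfolding f_def using q_pos N_ge T_sub 3 by (intro card_cross_close) auto
      moreover have "f u \<le> m" "f v \<le> m"
        unfolding f_def m_def using T_F uv finF by (auto intro!: card_mono)
      ultimately show ?thesis
        using p by linarith
    qed (auto simp: f_def)
  qed
  obtain h :: real where h: "sum w A \<le> h" "0 \<le> h" "h \<le> 1"
    and f_sum: "(\<Sum>u\<in>V. f u * w u) \<le> h * m + (1 - h) * (min q m * total)"
  proof (rule weighted_level_bound [of f m "min q m" A])
    show "f u \<le> m" if "u \<in> V" for u
      unfolding f_def m_def using T_F that finF by (intro card_mono)
  qed (use total_ge f_adj A A_adj in auto)
  have Q_le: "card Q \<le> q"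
  proof (cases "Q = {}")
    case False
    have "\<not> far N q i j" if "i \<in> Q" "j \<in> Q" for i j
      using no_adj [of "Apex i" "Apex j"] that by (auto simp: Q_def)
    then have "card Q + card Q \<le> 2 * q"
      using q_pos N_ge False by (intro card_cross_close [of q N]) (auto simp: Q_def)
    then show ?thesis by simp
  qed simp
  have covered: "card Q = 0 \<or> min N (card Q + q - 1) + m \<le> N"
  proof (cases "Q = {}")
    case False
    let ?U = "{l\<in>{..<N}. \<exists>k\<in>Q. 0 \<le> cyc_dist N k l \<and> cyc_dist N k l < 0 + q}"
    have "min (Suc N) (card Q + q) \<le> Suc (card ?U)"
      using False q_pos N_ge by (intro card_union_arcs) (auto simp: Q_def)
    moreover have "card ?U + m = card (?U \<union> F)"
      unfolding m_def using finF by (intro card_Un_disjoint [symmetric]) (auto simp: F_def)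
    moreover have "card (?U \<union> F) \<le> card {..<N}"
      by (intro card_mono) (auto simp: F_def)
    ultimately show ?thesis
      by (auto simp: min_def split: if_splits)
  qed simp
  define L where "L = layer_weight"
  define c where "c = apex_weight"
  have L: "L > 0" and c: "L \<le> c" "c \<le> 2 * L" and cq: "c * q = (2 * real q - 1) * L"
    using layer_weight_pos apex_weight_bounds q_times_apex_weight
    by (auto simp: L_def c_def mult.commute)
  have m_le: "m \<le> N"
    unfolding m_def using card_mono [of "{..<N}" F] by (auto simp: F_def)
  \<comment> \<open>The apices in \<open>Q\<close> must not outweigh the \<open>N - m\<close> layers
    they cover. An apex weighs \<open>(2 * q - 1) / q\<close> layers, and the arcs cover at least
    \<open>card Q + q - 1\<close> layers unless they cover the whole cycle; then
    \<open>card Q \<le> q\<close> suffices.\<close>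
  have at_one: "base_weight + L * m + card Q * c \<le> 1"
  proof -
    have "card Q * c \<le> L * (real N - real m)"
    proof (cases "card Q = 0")
      case False
      show ?thesis
      proof (cases "N \<le> card Q + q - 1")
        case True
        then have m0: "m = 0"
          using covered False by simp
        have "card Q * c \<le> q * c"
          using Q_le c L by (intro mult_right_mono) auto
        also have "\<dots> = (2 * real q - 1) * L"
          using cq by (simp add: mult.commute)
        also have "\<dots> \<le> N * L"
          using N_ge L by (intro mult_right_mono) auto
        finally show ?thesis
          using m0 by (simp add: mult.commute)
      next
        case 2: False
        then have "card Q + q + m \<le> N + 1"
          using covered False by (simp add: min_def split: if_splits)
        then have arc: "real (card Q) + real q - 1 \<le> real N - real m"
          by linarith
        have "real (card Q) * (real q - 1) \<le> q * (real q - 1)"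
          using Q_le q_pos by (intro mult_right_mono) auto
        then have "card Q * (2 * real q - 1) \<le> q * (card Q + real q - 1)"
          by (simp add: algebra_simps)
        also have "\<dots> \<le> q * (real N - real m)"
          using arc by (intro mult_left_mono) auto
        finally have le: "card Q * (2 * real q - 1) * L \<le> q * (real N - real m) * L"
          using L by (intro mult_right_mono) auto
        have "q * (card Q * c) = card Q * (c * q)"
          by simp
        also have "\<dots> = card Q * (2 * real q - 1) * L"
          unfolding cq by simp
        also note le
        also have "q * (real N - real m) * L = q * (L * (real N - real m))"
          by simp
        finally have "q * (card Q * c) \<le> q * (L * (real N - real m))" .
        then show ?thesis
          using q_pos by simp
      qed
    qed (use L m_le in auto)
    then show ?thesis
      by (simp add: base_weight_def L_def algebra_simps)
  qed
  \<comment> \<open>The comparison is with the weighted degree of an apex, formed by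
    \<open>N + 1 - 2 * q\<close> apices and \<open>q\<close> full layers. Each apex of
    \<open>Q\<close> in excess of that number lowers \<open>min q m\<close> by one, and an apex
    weighs at most a full layer.\<close>
  have at_zero: "L * (min q m * total) + card Q * c \<le> 1"
  proof -
    have deg: "q * (L * total) + (real N + 1 - 2 * real q) * c = 1"
      using apex_degree unfolding real_N by (simp add: L_def c_def)
    have cLt: "c \<le> L * total"
    proof -
      have "2 * L \<le> total * L"
        using total_ge L by (intro mult_right_mono) auto
      then show ?thesis
        using c(2) by (simp add: mult.commute)
    qed
    define g where "g = real (card Q) - (real N + 1 - 2 * real q)"
    have g_le: "g \<le> real q - min q m" if "g > 0"
    proof -
      have "card Q + 2 * q > N + 1"
        using that by (simp add: g_def)
      then show ?thesis
        using covered Q_le N_ge q_pos by (auto simp: g_def min_def split: if_splits)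
    qed
    have "g * c \<le> (real q - min q m) * (L * total)"
    proof (cases "g > 0")
      case True
      then show ?thesis
        using g_le cLt c L by (intro mult_mono) auto
    next
      case False
      then have "g * c \<le> 0"
        using c L by (simp add: mult_nonpos_nonneg)
      also have "0 \<le> (real q - min q m) * (L * total)"
        using L total_ge by (intro mult_nonneg_nonneg) auto
      finally show ?thesis .
    qed
    then show ?thesis
      using deg by (simp add: g_def algebra_simps)
  qed
  have "sum wt I \<le> base_weight * h + L * (h * m + (1 - h) * (min q m * total)) + card Q * c"
    unfolding sum_I L_def c_def using h f_sum base_weight_nonneg layer_weight_pos
    by (intro add_mono mult_left_mono) auto
  also have "\<dots> = h * (base_weight + L * m + card Q * c) + (1 - h) * (L * (min q m * total) + card Q * c)"
    by (simp add: algebra_simps)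
  also have "\<dots> \<le> h * 1 + (1 - h) * 1"
    using at_one at_zero h by (intro add_mono mult_left_mono) auto
  finally show ?thesis by simp
qed

lemma ext_tight_graph: "tight_graph adj' W wt"
proof -
  have "wt x \<ge> 0" if "x \<in> W" for x
    using that w_nonneg base_weight_nonneg layer_weight_pos apex_weight_bounds by (cases x) auto
  then show ?thesis
    by (intro tight_graph.intro tight_graph_axioms.intro ext_simple_graph finite_ext_vertices finite_V
      ext_triangle_free ext_degree ext_stable_le_one)
qed

text \<open>Base and layers together weigh \<open>total\<close>, because
  \<open>base_weight + N * layer_weight = 1\<close>; the gain is the weight of the \<open>N\<close>
  apices.\<close>

lemma ext_total:
  "sum wt W = total + N * (2 * real q - 1) / ((real q)\<^sup>2 * total + (real N + 1 - 2 * real q) * (2 * real q - 1))"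
proof -
  have "sum wt W = total * (base_weight + N * layer_weight) + N * apex_weight"
    using finite_V by (simp add: sum_ext_vertices total_def sum_distrib_right sum_distrib_left
      algebra_simps sum.distrib)
  also have "\<dots> = total + N * apex_weight"
    by (simp add: base_weight_def)
  finally have sum_wt: "sum wt W = total + N * apex_weight" .
  have "q * (real (N + 1 - 2 * q) * (real (2 * q - 1) / q)) = (real N + 1 - 2 * real q) * (2 * real q - 1)"
    unfolding real_q real_N using q_pos by simp
  then have denominator: "q * (q * total + (N + 1 - 2 * q) * ((2 * q - 1) / q))
      = (real q)\<^sup>2 * total + (real N + 1 - 2 * real q) * (2 * real q - 1)"
    by (simp add: distrib_left power2_eq_square)
  have "apex_weight = (2 * real q - 1) / (q * (q * total + (N + 1 - 2 * q) * ((2 * q - 1) / q)))"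
    unfolding apex_weight_def layer_weight_def real_q by simp
  then show ?thesis
    unfolding sum_wt denominator by simp
qed

end

section \<open>Attainable totals\<close>

text \<open>The vertex type is fixed because the existential cannot range over types;
  \<open>tight_totalI\<close> transfers graphs on other types.\<close>

definition tight_total :: "real \<Rightarrow> bool" where
  "tight_total x \<longleftrightarrow> (\<exists>(V :: nat set) adj w. tight_graph adj V w \<and> sum w V = x)"

lemma tight_totalI:
  assumes "tight_graph adj V w"
  shows "tight_total (sum w V)"
proof -
  interpret tight_graph adj V w by fact
  obtain f :: "'a \<Rightarrow> nat" where inj: "inj_on f V"
    using finite_imp_inj_to_nat_seg [OF finite_V] by blast
  define g where "g = inv_into V f"
  have g_f: "g (f v) = v" if "v \<in> V" for v
    using inj that by (simp add: g_def)
  have sum_f: "sum (\<lambda>i. w (g i)) (f ` A) = sum w A" if "A \<subseteq> V" for A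
  proof -
    have "sum (\<lambda>i. w (g i)) (f ` A) = sum (\<lambda>v. w (g (f v))) A"
      using that inj by (subst sum.reindex) (auto intro: inj_on_subset)
    also have "\<dots> = sum w A"
      using that g_f by (intro sum.cong) auto
    finally show ?thesis .
  qed
  define adj' where "adj' i j \<longleftrightarrow> i \<in> f ` V \<and> j \<in> f ` V \<and> adj (g i) (g j)" for i j
  interpret f: simple_graph adj'
    by unfold_locales (auto simp: adj'_def adj_irrefl dest: adj_sym)
  have adj'_f: "adj' (f u) (f v) \<longleftrightarrow> adj u v" if "u \<in> V" "v \<in> V" for u v
    using that by (simp add: adj'_def g_f)
  have "tight_graph adj' (f ` V) (\<lambda>i. w (g i))"
  proof unfold_locales
    show "finite (f ` V)"
      using finite_V by simp
    show "\<not> adj' x z" if "x \<in> f ` V" "y \<in> f ` V" "z \<in> f ` V" "adj' x y" "adj' y z" for x y z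
      using that triangle_free adj'_f by blast
    show "0 \<le> w (g i)" if "i \<in> f ` V" for i
      using that w_nonneg g_f by auto
    show "sum (\<lambda>i. w (g i)) (f.nbrs (f ` V) i) = 1" if "i \<in> f ` V" for i
    proof -
      obtain v where v: "v \<in> V" "i = f v"
        using \<open>i \<in> f ` V\<close> by auto
      then have "f.nbrs (f ` V) i = f ` nbrs V v"
        using adj'_f by (auto simp: nbrs_def f.nbrs_def)
      then show ?thesis
        using degree_one [OF v(1)] sum_f [OF nbrs_subset] by simp
    qed
    show "sum (\<lambda>i. w (g i)) A \<le> 1" if A: "A \<subseteq> f ` V" "stable adj' A" for A
    proof -
      obtain B where B: "B \<subseteq> V" "A = f ` B"
        using A(1) by (auto simp: subset_image_iff)
      have "\<not> adj u v" if uv: "u \<in> B" "v \<in> B" for u v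
      proof -
        have "\<not> adj' (f u) (f v)"
          using A(2) B(2) uv by (simp add: stable_def)
        then show ?thesis
          using adj'_f [of u v] uv B(1) by auto
      qed
      then have "stable adj B"
        by (simp add: stable_def)
      then show ?thesis
        using stable_le_one [OF B(1)] sum_f [OF B(1)] B by simp
    qed
  qed
  then show ?thesis
    unfolding tight_total_def using sum_f [of V] by blast
qed

lemma tight_total_2: "tight_total 2"
proof -
  define adj where "adj i j \<longleftrightarrow> i \<noteq> j" for i j :: bool
  interpret simple_graph adj
    by unfold_locales (auto simp: adj_def)
  have "tight_graph adj UNIV (\<lambda>_. 1)"
  proof unfold_locales
    show "sum (\<lambda>_. 1 :: real) (nbrs UNIV v) = 1" for v
    proof -
      have "nbrs UNIV v = {\<not> v}"
        by (auto simp: nbrs_def adj_def)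
      then show ?thesis by simp
    qed
    show "sum (\<lambda>_. 1 :: real) A \<le> 1" if "stable adj A" for A
    proof (cases "A = {}")
      case False
      then obtain v where "v \<in> A" by auto
      then have "A = {v}"
        using that by (auto simp: stable_def adj_def)
      then show ?thesis by simp
    qed simp
  qed (auto simp: adj_def)
  from tight_totalI [OF this] show ?thesis by simp
qed

lemma tight_total_step:
  assumes "tight_total x" "x \<ge> 2" "q \<ge> 1" "N < 3 * q" "2 * q \<le> N \<or> N = 1 \<and> q = 1"
  shows "tight_total (x + N * (2 * real q - 1) / ((real q)\<^sup>2 * x + (real N + 1 - 2 * real q) * (2 * real q - 1)))"
proof -
  obtain V :: "nat set" and adj w where tight: "tight_graph adj V w" and x: "sum w V = x"
    using assms(1) by (auto simp: tight_total_def)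
  interpret tight_graph adj V w by (rule tight)
  interpret cyclic_extension adj V w N q
    using assms x by unfold_locales (auto simp: total_def)
  show ?thesis
    using tight_totalI [OF ext_tight_graph] x by (simp add: ext_total total_def)
qed

section \<open>Totals along the Mycielski iteration and their refinement by long cycles\<close>

primrec mycielski_total :: "nat \<Rightarrow> real" where
  "mycielski_total 0 = 2"
| "mycielski_total (Suc k) = mycielski_total k + 1 / mycielski_total k"

lemma mycielski_total_ge_2: "mycielski_total k \<ge> 2"
  by (induction k) (auto intro: add_increasing2)

lemma tight_total_mycielski: "tight_total (mycielski_total k)"
proof (induction k)
  case (Suc k)
  then show ?case
    using tight_total_step [of "mycielski_total k" 1 1] mycielski_total_ge_2 by simp
qed (simp add: tight_total_2)

text \<open>Each step raises the square by at least two, so the totals are unbounded.\<close>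

lemma mycielski_total_sq: "(mycielski_total k)\<^sup>2 \<ge> 2 * k"
proof (induction k)
  case (Suc k)
  let ?x = "mycielski_total k"
  have "?x > 0"
    using mycielski_total_ge_2 [of k] by simp
  then have "(?x + 1 / ?x)\<^sup>2 = ?x\<^sup>2 + 2 + (1 / ?x)\<^sup>2"
    by (simp add: power2_sum)
  then have "2 * real k + 2 \<le> (?x + 1 / ?x)\<^sup>2"
    using Suc zero_le_power2 [of "1 / ?x"] by linarith
  then show ?case
    by simp
qed simp

text \<open>The index is the predecessor of the least \<open>k\<close> with
  \<open>x \<le> mycielski_total k + 4 / mycielski_total k\<close>. Passing to the predecessor costs
  \<open>1 / mycielski_total\<close>, which turns the 4 into a 5.\<close>

lemma exists_mycielski_total_between:
  assumes "x \<ge> 13"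
  obtains k where "mycielski_total k > 10" "mycielski_total k + 4 / mycielski_total k < x"
    "x \<le> mycielski_total k + 5 / mycielski_total k"
proof -
  let ?m = mycielski_total
  let ?P = "\<lambda>k. x \<le> ?m k + 4 / ?m k"
  obtain j :: nat where j: "x\<^sup>2 / 2 < j"
    using reals_Archimedean2 [of "x\<^sup>2 / 2"] by auto
  have "x\<^sup>2 < (?m j)\<^sup>2"
    using j mycielski_total_sq [of j] by linarith
  then have "x < ?m j"
    using mycielski_total_ge_2 [of j] by (simp add: power2_less_imp_less)
  then have "?P j"
    using mycielski_total_ge_2 [of j] by (simp add: add_increasing2)
  define k where "k = (LEAST k. ?P k)"
  have k: "?P k"
    unfolding k_def using \<open>?P j\<close> by (rule LeastI)
  then have "k \<noteq> 0"
    using assms by (cases "k = 0") auto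
  then obtain i where i: "k = Suc i"
    by (cases k) auto
  have nP: "\<not> ?P i"
    using not_less_Least [of i ?P] i by (simp add: k_def)
  have "?m i \<ge> 2" "?m k \<ge> 2"
    by (rule mycielski_total_ge_2)+
  then have bounds: "1 / ?m i \<le> 1 / 2" "4 / ?m k \<le> 4 / 2"
    by (intro divide_left_mono; simp)+
  have m_k: "?m k = ?m i + 1 / ?m i"
    by (simp add: i)
  have "?m i \<le> ?m k"
    using \<open>?m i \<ge> 2\<close> by (simp add: i)
  then have "4 / ?m k \<le> 4 / ?m i"
    using \<open>?m i \<ge> 2\<close> by (intro divide_left_mono) auto
  then have "x \<le> ?m i + (1 / ?m i + 4 / ?m i)"
    using k m_k \<open>4 / ?m k \<le> 4 / ?m i\<close> by linarith
  then have "x \<le> ?m i + 5 / ?m i"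
    by (simp flip: add_divide_distrib)
  moreover have "?m i > 10"
    using k bounds m_k assms by linarith
  ultimately show ?thesis
    using that nP by auto
qed

lemma floor_ratio_tendsto:
  assumes "\<eta> \<ge> 0"
  shows "(\<lambda>q. real (nat \<lfloor>\<eta> * real q\<rfloor>) / real q) \<longlonglongrightarrow> \<eta>"
proof (rule tendsto_sandwich)
  show "\<forall>\<^sub>F q in sequentially. \<eta> - 1 / real q \<le> real (nat \<lfloor>\<eta> * real q\<rfloor>) / real q"
    using eventually_gt_at_top [of 0]
  proof eventually_elim
    case (elim q)
    have "\<eta> * real q - 1 \<le> real (nat \<lfloor>\<eta> * real q\<rfloor>)"
      by linarith
    then have "(\<eta> * real q - 1) / real q \<le> real (nat \<lfloor>\<eta> * real q\<rfloor>) / real q"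
      by (intro divide_right_mono) auto
    then show ?case
      using elim by (simp add: diff_divide_distrib)
  qed
  show "\<forall>\<^sub>F q in sequentially. real (nat \<lfloor>\<eta> * real q\<rfloor>) / real q \<le> \<eta>"
    using eventually_gt_at_top [of 0]
  proof eventually_elim
    case (elim q)
    have "real (nat \<lfloor>\<eta> * real q\<rfloor>) \<le> \<eta> * real q"
      using assms by (simp add: of_nat_floor)
    then show ?case
      using elim by (simp add: field_simps)
  qed
  have "(\<lambda>q. \<eta> - 1 / real q) \<longlonglongrightarrow> \<eta> - 0"
    by (intro tendsto_intros lim_1_over_n)
  then show "(\<lambda>q. \<eta> - 1 / real q) \<longlonglongrightarrow> \<eta>" by simp
qed auto

text \<open>For \<open>N / q\<close> tending to \<open>\<eta>\<close>, the gain over a total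
  \<open>t\<close> tends to \<open>2 * \<eta> / (t + 2 * (\<eta> - 2))\<close>. It runs from
  \<open>4 / t\<close> to \<open>6 / (t + 2)\<close> as \<open>\<eta>\<close> goes from 2 to 3, and
  \<open>t > 10\<close> ensures that \<open>x - t\<close> falls in this range.\<close>

lemma tight_total_dense:
  assumes "x \<ge> 13" "\<epsilon> > 0"
  obtains y where "tight_total y" "x < y" "y < x + \<epsilon>"
proof -
  obtain k where "mycielski_total k > 10" "mycielski_total k + 4 / mycielski_total k < x"
      "x \<le> mycielski_total k + 5 / mycielski_total k"
    using exists_mycielski_total_between [OF assms(1)] .
  then obtain t where t: "t > 10" "t + 4 / t < x" "x \<le> t + 5 / t" "tight_total t"
    using tight_total_mycielski by metis
  have "5 / t < 6 / (t + 2)"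
    using t by (simp add: field_simps)
  define u where "u = x - t"
  have u: "4 / t < u" "u < 6 / (t + 2)"
    using t \<open>5 / t < 6 / (t + 2)\<close> by (auto simp: u_def)
  obtain s where s: "u < s" "s < min (u + \<epsilon>) (6 / (t + 2))"
    using dense [of u "min (u + \<epsilon>) (6 / (t + 2))"] u assms by auto
  have s1: "s < 1"
  proof -
    have "6 / (t + 2) < 1"
      using t by simp
    then show ?thesis using s by simp
  qed
  have ts: "4 < s * t" "s * (t + 2) < 6"
  proof -
    have "4 / t < s" "s < 6 / (t + 2)"
      using s u by auto
    then show "4 < s * t" "s * (t + 2) < 6"
      using t by (auto simp: field_simps)
  qed
  \<comment> \<open>The solution, in terms of \<open>2 * \<eta>\<close>, of the equation stating
    that the limiting gain equals \<open>s\<close>.\<close>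
  define \<zeta> where "\<zeta> = s * (t - 4) / (1 - s)"
  define \<eta> where "\<eta> = \<zeta> / 2"
  have \<eta>: "2 < \<eta>" "\<eta> < 3"
    using s1 ts by (auto simp: \<eta>_def \<zeta>_def field_simps)
  have \<eta>_eq: "2 * \<eta> / (t + (\<eta> - 2) * 2) = s"
  proof -
    have "\<zeta> * (1 - s) = s * (t - 4)"
      using s1 by (simp add: \<zeta>_def)
    then have "2 * \<eta> * (1 - s) = s * (t - 4)"
      by (simp add: \<eta>_def)
    then have "2 * \<eta> = s * (t + (\<eta> - 2) * 2)"
      by (simp add: algebra_simps)
    moreover have "t + (\<eta> - 2) * 2 > 0"
      using t \<eta> by simp
    ultimately show ?thesis by simp
  qed
  define N where "N q = nat \<lfloor>\<eta> * real q\<rfloor>" for q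
  define c where "c q = N q * (2 * real q - 1) / ((real q)\<^sup>2 * t + (real (N q) + 1 - 2 * real q) * (2 * real q - 1))" for q
  have ratio: "(\<lambda>q. real (N q) / real q) \<longlonglongrightarrow> \<eta>"
    unfolding N_def using \<eta> by (intro floor_ratio_tendsto) auto
  have "(\<lambda>q. (N q / q) * (2 - 1 / q) / (t + (N q / q + 1 / q - 2) * (2 - 1 / q)))
      \<longlonglongrightarrow> \<eta> * (2 - 0) / (t + (\<eta> + 0 - 2) * (2 - 0))"
    using t \<eta> by (intro tendsto_intros ratio lim_1_over_n) auto
  then have lim: "(\<lambda>q. (N q / q) * (2 - 1 / q) / (t + (N q / q + 1 / q - 2) * (2 - 1 / q))) \<longlonglongrightarrow> s"
    using \<eta>_eq by (simp add: mult.commute)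
  have "c \<longlonglongrightarrow> s"
  proof (rule Lim_transform_eventually [OF lim])
    show "\<forall>\<^sub>F q in sequentially.
        (N q / q) * (2 - 1 / q) / (t + (N q / q + 1 / q - 2) * (2 - 1 / q)) = c q"
      using eventually_gt_at_top [of 0]
    proof eventually_elim
      case (elim q)
      have num: "N q * (2 * real q - 1) = (real q)\<^sup>2 * ((N q / q) * (2 - 1 / q))"
        using elim by (simp add: power2_eq_square field_simps)
      have expand: "(real (N q) + 1 - 2 * real q) * (2 * real q - 1)
          = (q * (N q / q + 1 / q - 2)) * (q * (2 - 1 / q))"
        using elim by (simp add: algebra_simps)
      have den: "(real q)\<^sup>2 * t + (real (N q) + 1 - 2 * real q) * (2 * real q - 1)
          = (real q)\<^sup>2 * (t + (N q / q + 1 / q - 2) * (2 - 1 / q))"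
        unfolding expand by (simp only: power2_eq_square distrib_left mult_ac)
      show ?case
        using elim by (subst c_def, subst num, subst den) simp
    qed
  qed
  then have "\<forall>\<^sub>F q in sequentially. u < c q" "\<forall>\<^sub>F q in sequentially. c q < u + \<epsilon>"
    using s by (auto intro: order_tendstoD)
  then have "\<forall>\<^sub>F q in sequentially. u < c q \<and> c q < u + \<epsilon> \<and> q \<ge> 1"
    using eventually_ge_at_top [of 1] by eventually_elim auto
  then obtain q where q: "u < c q" "c q < u + \<epsilon>" "q \<ge> 1"
    using eventually_happens' [of sequentially] by auto
  have "2 * real q \<le> \<eta> * q" "\<eta> * q < 3 * real q"
    using \<eta> q by auto
  then have "2 * q \<le> N q" "N q < 3 * q"
    unfolding N_def by linarith+
  then have "tight_total (t + c q)"
    unfolding c_def using t q by (intro tight_total_step) auto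
  then show ?thesis
    using that [of "t + c q"] q by (simp add: u_def)
qed

section \<open>Blow-ups\<close>

lemma exists_large_fibres:
  fixes g :: "'b \<Rightarrow> nat"
  assumes "finite P" "P \<noteq> {}" "finite S" "sum g P \<le> card S"
  shows "\<exists>\<phi>. \<phi> ` S \<subseteq> P \<and> (\<forall>p\<in>P. g p \<le> card {x\<in>S. \<phi> x = p})"
  using assms
proof (induction P arbitrary: S rule: finite_ne_induct)
  case (singleton p)
  then show ?case
    by (intro exI [of _ "\<lambda>_. p"]) auto
next
  case (insert p P)
  have "g p \<le> card S"
    using insert by simp
  then obtain T where T: "T \<subseteq> S" "card T = g p"
    by (metis obtain_subset_with_card_n)
  have "sum g P \<le> card (S - T)"
    using insert T finite_subset [OF T(1)] by (simp add: card_Diff_subset)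
  then obtain \<phi> where \<phi>: "\<phi> ` (S - T) \<subseteq> P" "\<And>p. p \<in> P \<Longrightarrow> g p \<le> card {x\<in>S - T. \<phi> x = p}"
    using insert.IH [of "S - T"] insert.prems by blast
  define \<psi> where "\<psi> x = (if x \<in> T then p else \<phi> x)" for x
  have "g k \<le> card {x\<in>S. \<psi> x = k}" if k: "k \<in> insert p P" for k
  proof (cases "k = p")
    case True
    have "T \<subseteq> {x\<in>S. \<psi> x = k}"
      using T True by (auto simp: \<psi>_def)
    then show ?thesis
      using T True insert.prems card_mono [of "{x\<in>S. \<psi> x = k}" T] by auto
  next
    case False
    then have "{x\<in>S - T. \<phi> x = k} \<subseteq> {x\<in>S. \<psi> x = k}"
      by (auto simp: \<psi>_def)
    then have "card {x\<in>S - T. \<phi> x = k} \<le> card {x\<in>S. \<psi> x = k}"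
      using insert.prems by (intro card_mono) auto
    then show ?thesis
      using \<phi>(2) [of k] k False by auto
  qed
  moreover have "\<psi> ` S \<subseteq> insert p P"
    using \<phi>(1) by (auto simp: \<psi>_def)
  ultimately show ?case by blast
qed

text \<open>Fibres of size at least the floor of \<open>n * \<mu> p\<close> lose at most one vertex
  per point, which bounds every set from below. The upper bound is the lower bound for the
  complement, since the weights sum to one.\<close>

lemma exists_proportional_map:
  fixes \<mu> :: "'b \<Rightarrow> real"
  assumes P: "finite P" "sum \<mu> P = 1" and \<mu>: "\<And>p. p \<in> P \<Longrightarrow> \<mu> p \<ge> 0"
  obtains \<phi> :: "nat \<Rightarrow> 'b" where "\<phi> ` {..<n} \<subseteq> P"
    "\<And>I. I \<subseteq> P \<Longrightarrow> \<bar>real (card {x\<in>{..<n}. \<phi> x \<in> I}) - n * sum \<mu> I\<bar> \<le> card P"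
proof -
  define g where "g p = nat \<lfloor>n * \<mu> p\<rfloor>" for p
  have g: "real (g p) \<le> n * \<mu> p" "n * \<mu> p - 1 \<le> real (g p)" if "p \<in> P" for p
    using \<mu> [OF that] by (auto simp: g_def of_nat_floor)
  have "real (sum g P) \<le> (\<Sum>p\<in>P. n * \<mu> p)"
    unfolding of_nat_sum using g by (intro sum_mono) auto
  also have "\<dots> = n"
    using P by (simp flip: sum_distrib_left)
  finally have "sum g P \<le> card {..<n}"
    by (simp only: of_nat_le_iff card_lessThan flip: of_nat_sum)
  moreover have "P \<noteq> {}"
    using P by auto
  ultimately obtain \<phi> where \<phi>: "\<phi> ` {..<n} \<subseteq> P" "\<And>p. p \<in> P \<Longrightarrow> g p \<le> card {x\<in>{..<n}. \<phi> x = p}"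
    using exists_large_fibres [OF P(1), of "{..<n}" g] by auto
  have lower: "n * sum \<mu> I - card P \<le> card {x\<in>{..<n}. \<phi> x \<in> I}" if I: "I \<subseteq> P" for I
  proof -
    have finI: "finite I"
      using I P finite_subset by blast
    have "n * sum \<mu> I - card P \<le> n * sum \<mu> I - card I"
      using I P by (simp add: card_mono)
    also have "\<dots> = (\<Sum>p\<in>I. n * \<mu> p - 1)"
      by (simp add: sum_subtractf sum_distrib_left)
    also have "\<dots> \<le> (\<Sum>p\<in>I. real (card {x\<in>{..<n}. \<phi> x = p}))"
    proof (rule sum_mono)
      fix p assume "p \<in> I"
      then have "p \<in> P" using I by auto
      then show "n * \<mu> p - 1 \<le> real (card {x\<in>{..<n}. \<phi> x = p})"
        using g(2) [of p] \<phi>(2) [of p] by simp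
    qed
    also have "\<dots> = real (card (\<Union>p\<in>I. {x\<in>{..<n}. \<phi> x = p}))"
      using finI by (subst card_UN_disjoint) auto
    also have "(\<Union>p\<in>I. {x\<in>{..<n}. \<phi> x = p}) = {x\<in>{..<n}. \<phi> x \<in> I}"
      by auto
    finally show ?thesis .
  qed
  have upper: "card {x\<in>{..<n}. \<phi> x \<in> I} \<le> n * sum \<mu> I + card P" if I: "I \<subseteq> P" for I
  proof -
    have "card {x\<in>{..<n}. \<phi> x \<in> I} + card {x\<in>{..<n}. \<phi> x \<in> P - I}
        = card ({x\<in>{..<n}. \<phi> x \<in> I} \<union> {x\<in>{..<n}. \<phi> x \<in> P - I})"
      by (intro card_Un_disjoint [symmetric]) auto
    also have "{x\<in>{..<n}. \<phi> x \<in> I} \<union> {x\<in>{..<n}. \<phi> x \<in> P - I} = {..<n}"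
      using \<phi>(1) by auto
    finally have "real (card {x\<in>{..<n}. \<phi> x \<in> I}) + card {x\<in>{..<n}. \<phi> x \<in> P - I} = n"
      by (simp flip: of_nat_add)
    moreover have "sum \<mu> (P - I) = 1 - sum \<mu> I"
      using I P by (simp add: sum_diff)
    ultimately show ?thesis
      using lower [of "P - I"] by (simp add: right_diff_distrib)
  qed
  show ?thesis
    using that [of \<phi>] \<phi>(1) lower upper by (simp add: abs_le_iff algebra_simps)
qed

section \<open>Ramsey-Turan numbers\<close>

definition edge_rel :: "'a set set \<Rightarrow> 'a \<Rightarrow> 'a \<Rightarrow> bool" where
  "edge_rel E u v \<longleftrightarrow> {u, v} \<in> E"

lemma fin_graph_edge:
  assumes "fin_graph V E" "e \<in> E"
  obtains u v where "u \<in> V" "v \<in> V" "u \<noteq> v" "e = {u, v}"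
proof -
  have "e \<subseteq> V" "card e = 2"
    using assms by (auto simp: fin_graph_def nsets_def)
  then show ?thesis
    using that by (auto simp: card_2_iff)
qed

lemma edge_rel_simple_graph:
  assumes "fin_graph V E"
  shows "simple_graph (edge_rel E)"
proof
  show "edge_rel E u v \<Longrightarrow> edge_rel E v u" for u v
    by (simp add: edge_rel_def insert_commute)
  show "\<not> edge_rel E v v" for v
    using fin_graph_edge [OF assms, of "{v, v}"] by (auto simp: edge_rel_def doubleton_eq_iff)
qed

lemma degree_sum_eq_edges:
  assumes G: "fin_graph V E"
  shows "simple_graph.degree_sum (edge_rel E) V = 2 * card E"
proof -
  interpret simple_graph "edge_rel E"
    by (rule edge_rel_simple_graph [OF G])
  have finV: "finite V" and finE: "finite E"
    using G finite_imp_finite_nsets by (auto simp: fin_graph_def intro: finite_subset)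
  have "card (nbrs V v) = card {e\<in>E. v \<in> e}" if v: "v \<in> V" for v
  proof (rule bij_betw_same_card)
    show "bij_betw (\<lambda>u. {v, u}) (nbrs V v) {e\<in>E. v \<in> e}"
      unfolding bij_betw_def
    proof
      show "inj_on (\<lambda>u. {v, u}) (nbrs V v)"
        by (auto simp: inj_on_def doubleton_eq_iff)
      show "(\<lambda>u. {v, u}) ` nbrs V v = {e\<in>E. v \<in> e}"
      proof
        show "{e\<in>E. v \<in> e} \<subseteq> (\<lambda>u. {v, u}) ` nbrs V v"
        proof
          fix e assume e: "e \<in> {e\<in>E. v \<in> e}"
          then obtain x y where xy: "x \<in> V" "y \<in> V" "e = {x, y}"
            using fin_graph_edge [OF G] by blast
          then obtain u where "u \<in> V" "e = {v, u}"
            using e by (auto simp: insert_commute)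
          then show "e \<in> (\<lambda>u. {v, u}) ` nbrs V v"
            using e by (auto simp: nbrs_def edge_rel_def)
        qed
      qed (auto simp: nbrs_def edge_rel_def)
    qed
  qed
  then have "degree_sum V = (\<Sum>v\<in>V. card {e\<in>E. v \<in> e})"
    unfolding degree_sum_def by (intro sum.cong) auto
  also have "\<dots> = (\<Sum>e\<in>E. card {v\<in>V. v \<in> e})"
    using finV finE by (rule sum_card_swap)
  also have "\<dots> = (\<Sum>e\<in>E. 2)"
  proof (rule sum.cong)
    fix e assume "e \<in> E"
    then have "e \<subseteq> V" "card e = 2"
      using G by (auto simp: fin_graph_def nsets_def)
    moreover have "{v\<in>V. v \<in> e} = e"
      using \<open>e \<subseteq> V\<close> by auto
    ultimately show "card {v\<in>V. v \<in> e} = 2" by simp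
  qed simp
  finally show ?thesis by simp
qed

lemma contains_complete_graph_iff:
  assumes G: "fin_graph V E"
  shows "contains_subgraph (V, E) (complete_graph t) \<longleftrightarrow>
    (\<exists>K\<subseteq>V. pairwise (edge_rel E) K \<and> card K = t)"
proof
  assume "contains_subgraph (V, E) (complete_graph t)"
  then obtain f where f: "inj_on f {..<t}" "f ` {..<t} \<subseteq> V"
    and edges: "\<And>e. e \<in> [{..<t}]\<^bsup>2\<^esup> \<Longrightarrow> f ` e \<in> E"
    by (auto simp: contains_subgraph_def complete_graph_def)
  have "pairwise (edge_rel E) (f ` {..<t})"
  proof (rule pairwise_imageI)
    fix i j assume "i \<in> {..<t}" "j \<in> {..<t}" "i \<noteq> j"
    then have "f ` {i, j} \<in> E"
      by (intro edges) simp
    then show "edge_rel E (f i) (f j)"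
      by (simp add: edge_rel_def)
  qed
  then show "\<exists>K\<subseteq>V. pairwise (edge_rel E) K \<and> card K = t"
    using f by (intro exI [of _ "f ` {..<t}"]) (auto simp: card_image)
next
  assume "\<exists>K\<subseteq>V. pairwise (edge_rel E) K \<and> card K = t"
  then obtain K where K: "K \<subseteq> V" "pairwise (edge_rel E) K" "card K = t"
    by blast
  have "finite K"
    using G K finite_subset by (auto simp: fin_graph_def)
  then obtain f where f: "bij_betw f {..<t} K"
    using ex_bij_betw_nat_finite [of K] K by (auto simp: atLeast0LessThan)
  have "f ` e \<in> E" if "e \<in> [{..<t}]\<^bsup>2\<^esup>" for e
  proof -
    have "card e = 2" "e \<subseteq> {..<t}"
      using that by (auto simp: nsets_def)
    then obtain i j where ij: "e = {i, j}" "i \<noteq> j" "i < t" "j < t"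
      by (auto simp: card_2_iff)
    then have "f i \<in> K" "f j \<in> K" "f i \<noteq> f j"
      using f by (auto simp: bij_betw_def inj_on_def)
    then show ?thesis
      using K ij by (auto simp: pairwise_def edge_rel_def)
  qed
  then show "contains_subgraph (V, E) (complete_graph t)"
    unfolding contains_subgraph_def complete_graph_def
    using f K by (intro exI [of _ f]) (auto simp: bij_betw_def)
qed

lemma indep_iff_stable:
  assumes "fin_graph V E"
  shows "indep S E \<longleftrightarrow> stable (edge_rel E) S"
  using simple_graph.adj_irrefl [OF edge_rel_simple_graph [OF assms]]
  by (auto simp: indep_def stable_def edge_rel_def) (metis insert_absorb2)

lemma indep_number_less_iff:
  assumes G: "fin_graph V E"
  shows "real (indep_number V E) < m \<longleftrightarrow>
    (\<forall>S\<subseteq>V. stable (edge_rel E) S \<longrightarrow> real (card S) < m)"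
proof -
  let ?A = "{card S | S. S \<subseteq> V \<and> indep S E}"
  have "finite V"
    using G by (simp add: fin_graph_def)
  then have "?A \<subseteq> {..card V}"
    by (auto intro: card_mono)
  then have fin: "finite ?A"
    using finite_subset by blast
  have "card {} \<in> ?A"
    by (force simp: indep_def)
  then have "Max ?A \<in> ?A"
    using fin by (intro Max_in) auto
  then obtain S where S: "S \<subseteq> V" "stable (edge_rel E) S" "indep_number V E = card S"
    using indep_iff_stable [OF G] by (auto simp: indep_number_def)
  have "card T \<le> indep_number V E" if "T \<subseteq> V" "stable (edge_rel E) T" for T
    unfolding indep_number_def using fin that indep_iff_stable [OF G] by (intro Max_ge) auto
  then show ?thesis
    using S by (metis of_nat_mono order_le_less_trans)
qed

section \<open>Edge bounds for admissible graphs and the limit of the densities\<close>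

abbreviation admissible :: "nat \<Rightarrow> real \<Rightarrow> nat \<Rightarrow> nat set \<Rightarrow> nat set set \<Rightarrow> bool" where
  "admissible n m t V E \<equiv> fin_graph V E \<and> card V = n
     \<and> \<not> contains_subgraph (V, E) (complete_graph t) \<and> real (indep_number V E) < m"

text \<open>\<open>Max\<close> needs a finite nonempty set. The given graph makes it nonempty, and
  the uniform bound \<open>B\<close> makes it finite although infinitely many vertex sets are
  allowed.\<close>

lemma RT_bounds:
  fixes B :: real
  assumes adm: "admissible n m t V E"
    and upper: "\<And>V E. admissible n m t V E \<Longrightarrow> real (card E) \<le> B"
  shows "card E \<le> RT n m (complete_graph t)" "RT n m (complete_graph t) \<le> B"
proof -
  let ?A = "{card E | (V :: nat set) E. admissible n m t V E}"
  have "?A \<subseteq> {..nat \<lfloor>B\<rfloor>}"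
    using upper by (auto simp: le_nat_floor)
  then have fin: "finite ?A"
    using finite_subset by blast
  show "card E \<le> RT n m (complete_graph t)"
    unfolding RT_def using adm fin by (intro Max_ge) auto
  have "Max ?A \<in> ?A"
    using adm fin by (intro Max_in) auto
  then show "RT n m (complete_graph t) \<le> B"
    unfolding RT_def using upper by auto
qed

lemma admissible_edge_bound:
  assumes r: "r \<ge> 1" and adm: "admissible n (\<delta> * real n) (2 * r + 1) V E"
    and \<delta>: "8000 * real r ^ 4 * \<delta> \<le> 1"
  shows "card E \<le> (1 - 1 / r + \<delta>) * ((real n)\<^sup>2 / 2)"
proof -
  have G: "fin_graph V E" "card V = n"
    using adm by auto
  interpret simple_graph "edge_rel E"
    by (rule edge_rel_simple_graph [OF G(1)])
  interpret clique_free_graph "edge_rel E" V r "\<delta> * n"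
    using adm r contains_complete_graph_iff [OF G(1), of "2 * r + 1"] indep_number_less_iff [OF G(1)]
    by unfold_locales (auto simp: fin_graph_def)
  have "8000 * real r ^ 4 * \<delta> * n \<le> 1 * real n"
    using \<delta> by (intro mult_right_mono) auto
  then have "real (degree_sum V) \<le> (1 - 1 / r) * (real (card V))\<^sup>2 + \<delta> * n * card V"
    using G by (intro degree_sum_bound) (simp add: mult_ac)
  then show ?thesis
    using degree_sum_eq_edges [OF G(1)] G(2) by (simp add: algebra_simps power2_eq_square)
qed

text \<open>Weights are normalised so that each of the \<open>r\<close> joined copies has weight
  \<open>1 / r\<close>. A vertex sees all other copies and weight \<open>1 / (r * y)\<close> of its
  own, while a stable set lies in a single copy and has at most that weight. The constant
  \<open>C\<close> absorbs the rounding in the blow-up.\<close>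

lemma exists_admissible:
  assumes r: "r \<ge> 1" and y: "tight_total y" "y \<ge> 1" and \<delta>: "1 / (r * y) < \<delta>"
  obtains C where "\<And>n. real n * \<delta> > real n * (1 / (r * y)) + C \<Longrightarrow>
    \<exists>V E. admissible n (\<delta> * real n) (2 * r + 1) V E \<and>
      real n * (real n * (1 - 1 / r + 1 / (r * y)) - C) \<le> 2 * card E"
proof -
  obtain V :: "nat set" and adj w where tight: "tight_graph adj V w" and sum_w: "sum w V = y"
    using y by (auto simp: tight_total_def)
  interpret tight_graph adj V w by (rule tight)
  define P where "P = {..<r} \<times> V"
  define \<mu> where "\<mu> p = w (snd p) / (r * y)" for p :: "nat \<times> nat"
  define adj' where "adj' p p' \<longleftrightarrow> fst p \<noteq> fst p' \<or> adj (snd p) (snd p')" for p p' :: "nat \<times> nat"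
  have finP: "finite P"
    using finite_V by (simp add: P_def)
  have ry: "real r * y > 0"
    using r y by simp
  have sum_pair: "sum \<mu> (I \<times> A) = card I * (sum w A / (r * y))" for I A
    by (simp add: \<mu>_def sum_divide_distrib sum.cartesian_product')
  have sum_P: "sum \<mu> P = 1"
    using r y sum_pair by (simp add: P_def sum_w)
  have nonneg: "\<mu> p \<ge> 0" if "p \<in> P" for p
    using that w_nonneg ry by (auto simp: P_def \<mu>_def)
  have degree: "sum \<mu> {p'\<in>P. adj' p p'} = 1 - 1 / r + 1 / (r * y)" if p: "p \<in> P" for p
  proof -
    obtain i v where iv: "p = (i, v)" "i < r" "v \<in> V"
      using p by (auto simp: P_def)
    have "{p'\<in>P. adj' p p'} = ({..<r} - {i}) \<times> V \<union> {i} \<times> nbrs V v"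
      using iv by (auto simp: P_def adj'_def nbrs_def)
    then have "sum \<mu> {p'\<in>P. adj' p p'} = sum \<mu> (({..<r} - {i}) \<times> V) + sum \<mu> ({i} \<times> nbrs V v)"
      using finite_V by (simp only:) (intro sum.union_disjoint; auto)
    also have "\<dots> = (real r - 1) * (y / (r * y)) + 1 / (r * y)"
      using iv r by (simp only: sum_pair sum_w degree_one) (simp add: of_nat_diff)
    also have "\<dots> = 1 - 1 / r + 1 / (r * y)"
      using r y by (simp add: field_simps)
    finally show ?thesis .
  qed
  have stable_weight: "sum \<mu> I \<le> 1 / (r * y)" if I: "I \<subseteq> P" "stable adj' I" for I
  proof (cases "I = {}")
    case False
    then obtain i v where iv: "(i, v) \<in> I" by auto
    define A where "A = snd ` I"
    have fst_I: "fst p = i" if "p \<in> I" for p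
      using I(2) iv that by (force simp: stable_def adj'_def)
    have eq: "I = {i} \<times> A"
    proof
      show "I \<subseteq> {i} \<times> A"
        using fst_I by (force simp: A_def)
      show "{i} \<times> A \<subseteq> I"
        using fst_I by (force simp: A_def)
    qed
    have "A \<subseteq> V"
      using I(1) by (auto simp: A_def P_def)
    moreover have "stable adj A"
      using I(2) unfolding eq by (auto simp: stable_def adj'_def)
    ultimately have "sum w A \<le> 1"
      by (rule stable_le_one)
    then show ?thesis
      unfolding eq sum_pair using ry by (simp add: divide_right_mono)
  qed (use ry in simp)
  have no_clique: "card K \<noteq> 2 * r + 1" if K: "K \<subseteq> P" "pairwise adj' K" for K
  proof
    assume card: "card K = 2 * r + 1"
    have finK: "finite K"
      using K finP finite_subset by blast
    have "fst ` K \<subseteq> {..<r}"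
      using K by (auto simp: P_def)
    then have "card (fst ` K) \<le> r"
      using card_mono [of "{..<r}" "fst ` K"] by simp
    \<comment> \<open>With \<open>2 * r + 1\<close> vertices in at most \<open>r\<close> copies,
      three fall into the same copy and form a triangle there.\<close>
    have "\<exists>i. 3 \<le> card {p\<in>K. fst p = i}"
    proof (rule ccontr)
      assume "\<not> ?thesis"
      then have le2: "card {p\<in>K. fst p = i} \<le> 2" for i
        using not_less_eq_eq by (auto simp: not_le)
      have "card K = (\<Sum>p\<in>K. 1)" by simp
      also have "\<dots> = (\<Sum>i\<in>fst ` K. \<Sum>p\<in>{p\<in>K. fst p = i}. 1)"
        using finK by (intro sum.group [symmetric]) auto
      also have "\<dots> \<le> (\<Sum>i\<in>fst ` K. 2)"
        using le2 by (intro sum_mono) simp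
      finally show False
        using card \<open>card (fst ` K) \<le> r\<close> by simp
    qed
    then obtain i where "3 \<le> card {p\<in>K. fst p = i}" by blast
    then obtain L where L: "L \<subseteq> {p\<in>K. fst p = i}" "card L = 3"
      by (rule obtain_subset_with_card_n)
    then obtain x y z where xyz: "L = {x, y, z}" "x \<noteq> y" "y \<noteq> z" "x \<noteq> z"
      by (auto simp: card_3_iff)
    then have "adj' x y" "adj' y z" "adj' x z"
      using L K(2) by (auto simp: pairwise_def)
    moreover have "fst x = i" "fst y = i" "fst z = i" "snd x \<in> V" "snd y \<in> V" "snd z \<in> V"
      using xyz L K(1) by (auto simp: P_def)
    ultimately show False
      using triangle_free [of "snd x" "snd y" "snd z"] by (auto simp: adj'_def)
  qed
  define C where "C = real (card P)"
  show ?thesis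
  proof (rule that [of C])
    fix n :: nat
    assume large: "real n * \<delta> > real n * (1 / (r * y)) + C"
    obtain \<phi> :: "nat \<Rightarrow> nat \<times> nat" where \<phi>: "\<phi> ` {..<n} \<subseteq> P"
      and count: "\<And>I. I \<subseteq> P \<Longrightarrow> \<bar>real (card {x\<in>{..<n}. \<phi> x \<in> I}) - n * sum \<mu> I\<bar> \<le> card P"
      using exists_proportional_map [OF finP sum_P nonneg, of n] by blast
    have \<phi>_in: "\<phi> x \<in> P" if "x < n" for x
      using \<phi> that by auto
    define E where "E = {{x, y} | x y. x < n \<and> y < n \<and> adj' (\<phi> x) (\<phi> y)}"
    have irrefl: "\<not> adj' p p" and sym: "adj' p p' \<Longrightarrow> adj' p' p" for p p'
      using adj_irrefl adj_sym by (auto simp: adj'_def)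
    have rel: "edge_rel E x y \<longleftrightarrow> x < n \<and> y < n \<and> adj' (\<phi> x) (\<phi> y)" for x y
      using sym [of "\<phi> y" "\<phi> x"] by (auto simp: edge_rel_def E_def doubleton_eq_iff)
    have G: "fin_graph {..<n} E"
      using irrefl [of "\<phi> x" for x] by (auto simp: fin_graph_def E_def)
    have "\<not> contains_subgraph ({..<n}, E) (complete_graph (2 * r + 1))"
    proof
      assume "contains_subgraph ({..<n}, E) (complete_graph (2 * r + 1))"
      then obtain K where K: "K \<subseteq> {..<n}" "pairwise (edge_rel E) K" "card K = 2 * r + 1"
        using contains_complete_graph_iff [OF G] by blast
      have adj: "adj' (\<phi> x) (\<phi> y)" if "x \<in> K" "y \<in> K" "x \<noteq> y" for x y
        using K that rel by (auto simp: pairwise_def)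
      then have "inj_on \<phi> K"
        using irrefl by (metis inj_onI)
      then have "card (\<phi> ` K) = 2 * r + 1"
        using K by (simp add: card_image)
      moreover have "pairwise adj' (\<phi> ` K)"
        using adj by (intro pairwise_imageI) blast
      moreover have "\<phi> ` K \<subseteq> P"
        using K \<phi> by blast
      ultimately show False
        using no_clique by blast
    qed
    moreover have "real (indep_number {..<n} E) < \<delta> * n"
      unfolding indep_number_less_iff [OF G]
    proof (intro allI impI)
      fix S assume S: "S \<subseteq> {..<n}" "stable (edge_rel E) S"
      have "stable adj' (\<phi> ` S)"
        using S subsetD [OF S(1)] by (auto simp: stable_def rel)
      moreover have I: "\<phi> ` S \<subseteq> P"
        using S \<phi> by blast
      ultimately have "n * sum \<mu> (\<phi> ` S) \<le> n * (1 / (r * y))"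
        using stable_weight by (intro mult_left_mono) auto
      moreover have "card S \<le> card {x\<in>{..<n}. \<phi> x \<in> \<phi> ` S}"
        using S by (intro card_mono) auto
      ultimately show "real (card S) < \<delta> * n"
        using count [OF I] large by (simp add: C_def abs_le_iff mult.commute)
    qed
    moreover have "real n * (real n * (1 - 1 / r + 1 / (r * y)) - C) \<le> 2 * card E"
    proof -
      interpret G: simple_graph "edge_rel E"
        by (rule edge_rel_simple_graph [OF G])
      have deg: "real n * (1 - 1 / r + 1 / (r * y)) - C \<le> card (G.nbrs {..<n} x)" if x: "x \<in> {..<n}" for x
      proof -
        have "G.nbrs {..<n} x = {z\<in>{..<n}. \<phi> z \<in> {p'\<in>P. adj' (\<phi> x) p'}}"
          using x \<phi>_in rel by (auto simp: G.nbrs_def)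
        then show ?thesis
          using count [of "{p'\<in>P. adj' (\<phi> x) p'}"] degree [of "\<phi> x"] \<phi>_in x
          by (simp add: C_def abs_le_iff)
      qed
      have "real (card {..<n}) * (real n * (1 - 1 / r + 1 / (r * y)) - C)
          \<le> (\<Sum>x\<in>{..<n}. real (card (G.nbrs {..<n} x)))"
        using deg by (intro sum_bounded_below)
      also have "\<dots> = real (2 * card E)"
        using degree_sum_eq_edges [OF G] by (simp add: G.degree_sum_def flip: of_nat_sum)
      finally show ?thesis by simp
    qed
    ultimately show "\<exists>V E. admissible n (\<delta> * real n) (2 * r + 1) V E \<and>
      real n * (real n * (1 - 1 / r + 1 / (r * y)) - C) \<le> 2 * card E"
      using G by (intro exI [of _ "{..<n}"] exI [of _ E]) simp
  qed
qed

lemma RT_ratio_tendsto: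
  assumes r: "r \<ge> 1" and \<delta>: "\<delta> > 0" "8000 * real r ^ 4 * \<delta> \<le> 1"
  shows "RT_ratio (2 * r + 1) \<delta> \<longlonglongrightarrow> (real r - 1) / real r + \<delta>"
proof (rule LIMSEQ_I)
  fix \<epsilon> :: real
  assume \<epsilon>: "\<epsilon> > 0"
  \<comment> \<open>A graph of total exactly \<open>x\<close> would give blow-ups with stable sets
    of density \<open>\<delta>\<close>. A slightly larger total \<open>y\<close> leaves room below
    \<open>\<delta>\<close> for rounding.\<close>
  define x where "x = 1 / (r * \<delta>)"
  have "real r \<le> real r ^ 4"
    using r power_increasing [of 1 4 "real r"] by simp
  then have "13 * real r \<le> 8000 * real r ^ 4"
    by linarith
  then have "13 * real r * \<delta> \<le> 8000 * real r ^ 4 * \<delta>"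
    using \<delta>(1) by (intro mult_right_mono) auto
  then have "13 * (real r * \<delta>) \<le> 1"
    using \<delta> by linarith
  then have x: "x \<ge> 13"
    using r \<delta> by (simp add: x_def field_simps)
  obtain y where y: "tight_total y" "x < y" "y < x + \<epsilon> / 2"
    using tight_total_dense [OF x, of "\<epsilon> / 2"] \<epsilon> by auto
  have \<delta>_x: "\<delta> = 1 / (r * x)"
    using r \<delta> by (simp add: x_def)
  have "1 / (r * y) < \<delta>"
    unfolding \<delta>_x using y x r by (intro divide_strict_left_mono) auto
  have close: "\<delta> - \<epsilon> / 2 \<le> 1 / (r * y)"
  proof -
    have "1 * 1 \<le> real r * (x * y)"
      using r x y mult_mono [of 1 x 1 y] by (intro mult_mono) auto
    then have "(y - x) / (real r * (x * y)) \<le> (y - x) / 1"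
      using y by (intro divide_left_mono) auto
    moreover have "1 / (r * x) - 1 / (r * y) = (y - x) / (real r * (x * y))"
      using r x y by (simp add: field_simps)
    ultimately show ?thesis
      using y \<delta>_x by simp
  qed
  obtain C where C: "\<And>n. real n * \<delta> > real n * (1 / (r * y)) + C \<Longrightarrow>
    \<exists>V E. admissible n (\<delta> * real n) (2 * r + 1) V E \<and>
      real n * (real n * (1 - 1 / r + 1 / (r * y)) - C) \<le> 2 * card E"
    using exists_admissible [OF r y(1) _ \<open>1 / (r * y) < \<delta>\<close>] x y(2) by auto
  \<comment> \<open>Once \<open>n * \<gamma>\<close> exceeds \<open>\<bar>C\<bar>\<close>, the
    rounding error fits into the gap below \<open>\<delta>\<close> and costs less than a quarter of
    \<open>\<epsilon>\<close>; replacing \<open>x\<close> by \<open>y\<close> costs at most half of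
    it.\<close>
  define \<gamma> where "\<gamma> = min (\<delta> - 1 / (r * y)) (\<epsilon> / 4)"
  have "\<gamma> > 0"
    using \<open>1 / (r * y) < \<delta>\<close> \<epsilon> by (simp add: \<gamma>_def)
  moreover have "\<gamma> \<le> \<delta> - 1 / (r * y)" "\<gamma> \<le> \<epsilon> / 4"
    unfolding \<gamma>_def by (rule min.cobounded1, rule min.cobounded2)
  ultimately have \<gamma>: "\<gamma> > 0" "\<gamma> \<le> \<delta> - 1 / (r * y)" "\<gamma> \<le> \<epsilon> / 4" .
  obtain n0 :: nat where n0: "\<bar>C\<bar> / \<gamma> < n0"
    using reals_Archimedean2 by blast
  show "\<exists>n0. \<forall>n\<ge>n0. norm (RT_ratio (2 * r + 1) \<delta> n - ((real r - 1) / real r + \<delta>)) < \<epsilon>"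
  proof (intro exI [of _ n0] allI impI)
    fix n assume "n \<ge> n0"
    then have "\<bar>C\<bar> / \<gamma> < n"
      using n0 by linarith
    then have C_n: "\<bar>C\<bar> < n * \<gamma>"
      using \<gamma> by (simp add: field_simps)
    then have n: "n > 0"
      by (intro gr0I) auto
    have "n * \<gamma> \<le> n * (\<delta> - 1 / (r * y))"
      using \<gamma> by (intro mult_left_mono) auto
    then have "real n * \<delta> > real n * (1 / (r * y)) + C"
      using C_n by (simp add: right_diff_distrib)
    then obtain V E where adm: "admissible n (\<delta> * real n) (2 * r + 1) V E"
      and edges: "real n * (real n * (1 - 1 / r + 1 / (r * y)) - C) \<le> 2 * card E"
      using C by blast
    have upper: "real (card E') \<le> (1 - 1 / r + \<delta>) * ((real n)\<^sup>2 / 2)"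
      if "admissible n (\<delta> * real n) (2 * r + 1) V' E'" for V' E'
      by (rule admissible_edge_bound [OF r that \<delta>(2)])
    have RT_ge: "card E \<le> RT n (\<delta> * real n) (complete_graph (2 * r + 1))"
      by (rule RT_bounds(1) [OF adm]) (erule upper)
    have RT_le: "RT n (\<delta> * real n) (complete_graph (2 * r + 1)) \<le> (1 - 1 / r + \<delta>) * ((real n)\<^sup>2 / 2)"
      by (rule RT_bounds(2) [OF adm]) (erule upper)
    have sq: "(real n)\<^sup>2 / 2 > 0"
      using n by simp
    have "RT_ratio (2 * r + 1) \<delta> n \<le> 1 - 1 / r + \<delta>"
      unfolding RT_ratio_def using RT_le sq by (simp add: pos_divide_le_eq)
    moreover have "1 - 1 / r + \<delta> - \<epsilon> < RT_ratio (2 * r + 1) \<delta> n"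
    proof -
      have "n * \<gamma> \<le> n * (\<epsilon> / 4)"
        using \<gamma> by (intro mult_left_mono) auto
      moreover have "real n * (\<delta> - \<epsilon> / 2) \<le> n * (1 / (r * y))"
        using close by (intro mult_left_mono) auto
      moreover have "0 < real n * (\<epsilon> / 4)"
        using n \<epsilon> by simp
      ultimately have "n * (1 - 1 / r + \<delta> - \<epsilon>) < n * (1 - 1 / r + 1 / (r * y)) - C"
        using C_n by (simp add: algebra_simps)
      then have "n * (n * (1 - 1 / r + \<delta> - \<epsilon>)) < n * (n * (1 - 1 / r + 1 / (r * y)) - C)"
        using n by (intro mult_strict_left_mono) auto
      also have "\<dots> \<le> 2 * RT n (\<delta> * real n) (complete_graph (2 * r + 1))"
        using edges RT_ge by linarith
      finally show ?thesis
        unfolding RT_ratio_def using sq by (simp add: pos_less_divide_eq power2_eq_square mult_ac)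
    qed
    moreover have "(real r - 1) / real r = 1 - 1 / r"
      using r by (simp add: diff_divide_distrib)
    ultimately show "norm (RT_ratio (2 * r + 1) \<delta> n - ((real r - 1) / real r + \<delta>)) < \<epsilon>"
      using \<epsilon> by (simp add: abs_less_iff)
  qed
qed

theorem theorem1p3:
  fixes r :: nat
  assumes "r \<ge> 1"
  shows "\<exists>\<delta>\<^sub>0>0. \<forall>\<delta>::real. 0 < \<delta> \<and> \<delta> < \<delta>\<^sub>0 \<longrightarrow>
           convergent (RT_ratio (2 * r + 1) \<delta>) \<and>
           RT_density (2 * r + 1) \<delta> = (real r - 1) / real r + \<delta>"
proof (intro exI [of _ "1 / (8000 * real r ^ 4)"] conjI allI impI)
  \<comment> \<open>The threshold makes \<open>degree_sum_bound\<close> applicable with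
    \<open>a = \<delta> * n\<close>. It is also below \<open>1 / (13 * r)\<close>, as the density of
    attainable totals requires.\<close>
  show "0 < 1 / (8000 * real r ^ 4)"
    using assms by simp
  fix \<delta> :: real
  assume \<delta>: "0 < \<delta> \<and> \<delta> < 1 / (8000 * real r ^ 4)"
  then have "8000 * real r ^ 4 * \<delta> \<le> 1"
    using assms by (simp add: field_simps)
  then have lim: "RT_ratio (2 * r + 1) \<delta> \<longlonglongrightarrow> (real r - 1) / real r + \<delta>"
    using assms \<delta> by (intro RT_ratio_tendsto) auto
  then show "convergent (RT_ratio (2 * r + 1) \<delta>)"
    by (rule convergentI)
  show "RT_density (2 * r + 1) \<delta> = (real r - 1) / real r + \<delta>"
    unfolding RT_density_def using lim by (rule limI)
qed

end
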